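(* Let $H$ be a separable Hilbert space and $p\in(0,1)$. Let $S,T\in\mathcal B(H)$ be such that $[S,T]\in\mathcal L^p(H)$, and let $\Gamma$ be a simple closed $C^1$-curve in the resolvent set $\mathbb C\setminus\sigma(S)$. Then the map $F:\Gamma\to\mathcal L^p(H)$ given by $$F(z)=[(z-S)^{-1},T]$$ is Riemann integrable.
   Context: $\mathcal L^p(H)$ is the Schatten $p$-ideal of compact operators on $H$ whose singular value sequence lies in $\ell^p(\mathbb N)$, with quasi-norm $\|T\|_p=\|(s_n(T))_{n\in\mathbb N}\|_{\ell^p}$; for $p\in(0,1)$ it is a quasi-Banach space. Riemann integrability along $\Gamma$ of a function with values in a quasi-Banach space is defined in exactly the same way as for Banach space valued functions, with convergence of the Riemann sums (as the mesh of the partition tends to $0$) in the quasi-norm. $\sigma(S)$ is the spectrum of $S$ and $[S,T]=ST-TS$. *)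

theory Defs
  imports "HOL-Analysis.Analysis"
begin

text \<open>
  Complex Hilbert spaces.  The inner product is linear in its second argument, and the real inner
  product inherited from \<^class>\<open>real_inner\<close> is its real part; hence \<open>cinner x x = (norm x)\<^sup>2\<close>, and
  norm, metric and topology are those of the complex Hilbert space.
\<close>

class chilbert_space = real_inner + banach +
  fixes scaleC :: "complex \<Rightarrow> 'a \<Rightarrow> 'a"  (infixr "*\<^sub>C" 75)
    and cinner :: "'a \<Rightarrow> 'a \<Rightarrow> complex"
  assumes scaleC_add_right: "c *\<^sub>C (x + y) = c *\<^sub>C x + c *\<^sub>C y"
    and scaleC_add_left: "(c + d) *\<^sub>C x = c *\<^sub>C x + d *\<^sub>C x"
    and scaleC_scaleC: "c *\<^sub>C (d *\<^sub>C x) = (c * d) *\<^sub>C x"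
    and scaleC_of_real: "complex_of_real r *\<^sub>C x = r *\<^sub>R x"
    and cinner_commute: "cinner x y = cnj (cinner y x)"
    and cinner_add_right: "cinner x (y + z) = cinner x y + cinner x z"
    and cinner_scaleC_right: "cinner x (c *\<^sub>C y) = c * cinner x y"
    and Re_cinner: "Re (cinner x y) = inner x y"

instantiation complex :: chilbert_space
begin

definition scaleC_complex :: "complex \<Rightarrow> complex \<Rightarrow> complex"
  where "scaleC_complex c x = c * x"

definition cinner_complex :: "complex \<Rightarrow> complex \<Rightarrow> complex"
  where "cinner_complex x y = cnj x * y"

instance
  by standard (auto simp: scaleC_complex_def cinner_complex_def inner_complex_def
      algebra_simps scaleR_conv_of_real)

end

global_interpretation complex_vector: vector_space
  "scaleC :: complex \<Rightarrow> 'a \<Rightarrow> 'a::chilbert_space"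
proof
  show "1 *\<^sub>C x = x" for x :: 'a
    using scaleC_of_real[of 1 x] by simp
qed (auto simp: scaleC_add_right scaleC_add_left scaleC_scaleC)

text \<open>
  Operators are functions on the whole space; the elements of \<open>B(H)\<close> are those satisfying
  \<open>bounded_clinear\<close>.
\<close>

definition bounded_clinear :: "('a::chilbert_space \<Rightarrow> 'a) \<Rightarrow> bool"
  where "bounded_clinear T \<longleftrightarrow> bounded_linear T \<and> (\<forall>c x. T (c *\<^sub>C x) = c *\<^sub>C T x)"

definition commutator :: "('a::chilbert_space \<Rightarrow> 'a) \<Rightarrow> ('a \<Rightarrow> 'a) \<Rightarrow> 'a \<Rightarrow> 'a"
  where "commutator S T = (\<lambda>x. S (T x) - T (S x))"

definition spectrum :: "('a::chilbert_space \<Rightarrow> 'a) \<Rightarrow> complex set"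
  where "spectrum S =
    {z. \<not> (\<exists>R. bounded_clinear R \<and>
              (\<forall>x. R (z *\<^sub>C x - S x) = x) \<and> (\<forall>x. z *\<^sub>C R x - S (R x) = x))}"

text \<open>This is \<open>(z - S)\<^sup>-\<^sup>1\<close>; it is meaningful for \<open>z\<close> outside the spectrum of \<open>S\<close>.\<close>

definition resolvent :: "('a::chilbert_space \<Rightarrow> 'a) \<Rightarrow> complex \<Rightarrow> 'a \<Rightarrow> 'a"
  where "resolvent S z = inv (\<lambda>x. z *\<^sub>C x - S x)"

definition adjoint_op :: "('a::chilbert_space \<Rightarrow> 'a) \<Rightarrow> 'a \<Rightarrow> 'a"
  where "adjoint_op T = (THE A. \<forall>x y. cinner (A x) y = cinner x (T y))"

definition compact_op :: "('a::chilbert_space \<Rightarrow> 'a) \<Rightarrow> bool"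
  where "compact_op T \<longleftrightarrow> bounded_clinear T \<and> compact (closure (T ` cball 0 1))"

definition eigenspace :: "('a::chilbert_space \<Rightarrow> 'a) \<Rightarrow> complex \<Rightarrow> 'a set"
  where "eigenspace A c = {x. A x = c *\<^sub>C x}"

text \<open>
  The singular values of a compact operator \<open>T\<close>, indexed from \<open>0\<close>: the square roots of the nonzero
  eigenvalues of \<open>T\<^sup>* T\<close> in non-increasing order, each repeated according to its (finite)
  multiplicity, and padded with zeros if there are only finitely many of them.  The finiteness
  clause is needed because \<^const>\<open>card\<close> is \<open>0\<close> on infinite sets.
\<close>

definition singular_value :: "('a::chilbert_space \<Rightarrow> 'a) \<Rightarrow> nat \<Rightarrow> real"
  where "singular_value T = (THE s.
    antimono s \<and> (\<forall>n. 0 \<le> s n) \<and>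
    (\<forall>r>0. finite {n. s n = r} \<and>
           card {n. s n = r} =
             complex_vector.dim (eigenspace (adjoint_op T \<circ> T) (complex_of_real (r\<^sup>2)))))"

definition schatten_class :: "real \<Rightarrow> ('a::chilbert_space \<Rightarrow> 'a) set"
  where "schatten_class p = {T. compact_op T \<and> summable (\<lambda>n. singular_value T n powr p)}"

definition schatten_norm :: "real \<Rightarrow> ('a::chilbert_space \<Rightarrow> 'a) \<Rightarrow> real"
  where "schatten_norm p T = (\<Sum>n. singular_value T n powr p) powr (1 / p)"

text \<open>
  Closed curves are parametrised by \<open>{0..1}\<close>, with one-sided derivatives at the endpoints.
\<close>

definition C1_simple_closed_curve :: "(real \<Rightarrow> complex) \<Rightarrow> bool"
  where "C1_simple_closed_curve \<gamma> \<longleftrightarrow>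
    simple_path \<gamma> \<and> pathfinish \<gamma> = pathstart \<gamma> \<and>
    (\<exists>\<gamma>'. continuous_on {0..1} \<gamma>' \<and>
      (\<forall>t\<in>{0..1}. (\<gamma> has_vector_derivative \<gamma>' t) (at t within {0..1})))"

text \<open>
  A tagged partition \<open>0 = t 0 < t 1 < \<dots> < t n = 1\<close> with tags \<open>\<tau> j\<close> and mesh less than \<open>\<delta>\<close>,
  and the associated Riemann sum
  \<open>\<Sum>j<n. (\<gamma> (t (j + 1)) - \<gamma> (t j)) F(\<gamma> (\<tau> j))\<close> of an operator-valued function \<open>F\<close> along \<open>\<gamma>\<close>.
\<close>

definition tagged_partition :: "real \<Rightarrow> nat \<Rightarrow> (nat \<Rightarrow> real) \<Rightarrow> (nat \<Rightarrow> real) \<Rightarrow> bool"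
  where "tagged_partition \<delta> n t \<tau> \<longleftrightarrow>
    t 0 = 0 \<and> t n = 1 \<and>
    (\<forall>j<n. t j < t (Suc j) \<and> t (Suc j) - t j < \<delta> \<and> \<tau> j \<in> {t j..t (Suc j)})"

definition riemann_sum ::
  "(real \<Rightarrow> complex) \<Rightarrow> (complex \<Rightarrow> 'a::chilbert_space \<Rightarrow> 'a) \<Rightarrow>
    nat \<Rightarrow> (nat \<Rightarrow> real) \<Rightarrow> (nat \<Rightarrow> real) \<Rightarrow> 'a \<Rightarrow> 'a"
  where "riemann_sum \<gamma> F n t \<tau> =
    (\<lambda>x. \<Sum>j<n. (\<gamma> (t (Suc j)) - \<gamma> (t j)) *\<^sub>C F (\<gamma> (\<tau> j)) x)"

text \<open>
  Riemann integrability along \<open>\<gamma>\<close> of a function with values in a space \<open>V\<close> of operators with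
  quasi-norm \<open>q\<close>.
\<close>

definition riemann_integrable_along ::
  "(real \<Rightarrow> complex) \<Rightarrow> ('a::chilbert_space \<Rightarrow> 'a) set \<Rightarrow> (('a \<Rightarrow> 'a) \<Rightarrow> real) \<Rightarrow>
    (complex \<Rightarrow> 'a \<Rightarrow> 'a) \<Rightarrow> bool"
  where "riemann_integrable_along \<gamma> V q F \<longleftrightarrow>
    (\<exists>I\<in>V. \<forall>\<epsilon>>0. \<exists>\<delta>>0. \<forall>n t \<tau>. tagged_partition \<delta> n t \<tau> \<longrightarrow>
      (\<lambda>x. riemann_sum \<gamma> F n t \<tau> x - I x) \<in> V \<and>
      q (\<lambda>x. riemann_sum \<gamma> F n t \<tau> x - I x) < \<epsilon>)"

end

theory Submission
  imports Defs
begin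

text \<open>
  For \<open>z\<close> in the resolvent set, \<open>[(z - S)\<^sup>-\<^sup>1, T] = (z - S)\<^sup>-\<^sup>1 [S, T] (z - S)\<^sup>-\<^sup>1\<close>, so \<open>F\<close> takes values in the
  Schatten class by the ideal property.  Its integrability is more delicate, because in a
  quasi-Banach space that is not locally convex a continuous function need not be Riemann integrable.
  Analyticity helps: near a point \<open>w\<close> of the curve,
  \<open>F z = (\<Sum>k. (w - z) ^ k B k)\<close> with \<open>B k = [(w - S) ^ -(k + 1), T]\<close>, and the \<open>p\<close>-th powers of the quasi-norms
  of the \<open>B k\<close> grow at most geometrically (\<open>schatten_commutator_power\<close>).  A Riemann sum of such an \<open>F\<close> is
  \<open>\<Sum>k. c k B k\<close> with the scalar Riemann sums \<open>c k\<close> of \<open>(w - z) ^ k\<close>.  These converge for each \<open>k\<close>, with a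
  geometric bound that is uniform in the partition; if \<open>z\<close> stays close enough to \<open>w\<close>, then the series
  converges in quasi-norm, uniformly, whatever the constant in the quasi-triangle inequality is
  (\<open>schatten_integrable_series\<close>).  The local results are joined by bisection of the parameter interval,
  with functions extended constantly beyond their interval so that partitions never have to be cut
  (\<open>schatten_integrable_commutator_resolvent\<close>).

  Four properties of the Schatten class enter: the ideal property, the quasi-triangle inequality, the
  domination of the operator norm, and lower semicontinuity under operator norm limits.  They follow
  directly if the quasi-norm is formed with the Gelfand numbers of \<open>T\<close>, of which the \<open>n\<close>-th is the
  infimum of the norms of the restrictions of \<open>T\<close> to orthogonal complements of at most \<open>n\<close> vectors.  So the singular values, which are defined by the multiplicities of the eigenvalues of \<open>T\<^sup>* T\<close>, have to
  be identified with the Gelfand numbers of \<open>T\<close> (\<open>singular_value_eq_gelfand_number\<close>).  This is the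
  min-max principle.  It uses a maximal orthonormal system of eigenvectors of \<open>T\<^sup>* T\<close> for nonzero
  eigenvalues and the fact that a compact operator attains its norm on the complement of such vectors.
\<close>

section \<open>Complex Hilbert spaces and adjoints\<close>

lemma
  fixes x y z :: "'a::chilbert_space"
  shows cinner_add_left: "cinner (x + y) z = cinner x z + cinner y z"
    and cinner_scaleC_left: "cinner (c *\<^sub>C x) y = cnj c * cinner x y"
    and cinner_zero_right: "cinner x 0 = 0"
    and cinner_diff_right: "cinner x (y - z) = cinner x y - cinner x z"
    and cinner_diff_left: "cinner (x - y) z = cinner x z - cinner y z"
proof -
  show *: "cinner (x + y) z = cinner x z + cinner y z" for x y z :: 'a
    by (metis cinner_add_right cinner_commute complex_cnj_add)
  show "cinner (c *\<^sub>C x) y = cnj c * cinner x y"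
    by (metis cinner_commute cinner_scaleC_right complex_cnj_mult)
  show "cinner x 0 = 0" using cinner_add_right[of x 0 0] by simp
  show "cinner x (y - z) = cinner x y - cinner x z"
    using cinner_add_right[of x "y - z" z] by simp
  show "cinner (x - y) z = cinner x z - cinner y z"
    using *[of "x - y" y z] by simp
qed

lemma cinner_sum_right: "cinner x (\<Sum>i\<in>A. f i) = (\<Sum>i\<in>A. cinner x (f i))"
  by (induction A rule: infinite_finite_induct) (simp_all add: cinner_zero_right cinner_add_right)

lemma cinner_self: "cinner x x = complex_of_real ((norm x)\<^sup>2)"
proof (rule complex_eqI)
  show "Re (cinner x x) = Re (complex_of_real ((norm x)\<^sup>2))"
    by (simp add: Re_cinner power2_norm_eq_inner)
  have "Im (cinner x x) = - Im (cinner x x)"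
    by (metis cinner_commute cnj.simps(2))
  then show "Im (cinner x x) = Im (complex_of_real ((norm x)\<^sup>2))" by simp
qed

lemma cinner_eq_zero_commute: "cinner x y = 0 \<longleftrightarrow> cinner y x = 0"
  by (metis cinner_commute complex_cnj_zero)

lemma norm_scaleC: "norm (c *\<^sub>C x) = cmod c * norm (x::'a::chilbert_space)"
proof -
  have "complex_of_real ((norm (c *\<^sub>C x))\<^sup>2) = complex_of_real ((cmod c * norm x)\<^sup>2)"
    unfolding cinner_self[symmetric] cinner_scaleC_left cinner_scaleC_right
    using complex_norm_square[of c] by (simp add: cinner_self power_mult_distrib mult.commute)
  then show ?thesis
    by (metis mult_nonneg_nonneg norm_ge_zero of_real_eq_iff power2_eq_iff_nonneg)
qed

lemma inner_eq_Re_cinner: "inner x y = Re (cinner x y)"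
  by (simp add: Re_cinner)

text \<open>
  A complex linear functional is determined by its real part, since \<open>Im (f y) = - Re (f (\<i> y))\<close>.  This
  reduces the existence of adjoints to the real Riesz representation.
\<close>

lemma cinner_eq_iff_Re:
  assumes "\<And>y. Re (f (\<i> *\<^sub>C y)) = Re (\<i> * f y)" "\<And>y. Re (cinner a y) = Re (f y)"
  shows "cinner a y = f y"
proof (rule complex_eqI)
  show "Im (cinner a y) = Im (f y)"
    using assms(1)[of y] assms(2)[of "\<i> *\<^sub>C y"] by (simp add: cinner_scaleC_right)
qed (use assms in simp)

text \<open>
  Minimise \<open>(norm x)\<^sup>2 - 2 f x\<close>: by the parallelogram law every minimising sequence is Cauchy, and the
  first-order condition at the minimum says that \<open>f\<close> is the inner product with the minimiser.
\<close>

lemma riesz_representation: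
  fixes f :: "'a::{real_inner, banach} \<Rightarrow> real"
  assumes "bounded_linear f"
  shows "\<exists>y. \<forall>x. f x = inner y x"
proof -
  interpret f: bounded_linear f by fact
  obtain K where K: "\<And>x. norm (f x) \<le> norm x * K" using f.bounded by blast
  define J where "J x = (norm x)\<^sup>2 - 2 * f x" for x
  have Jlow: "- K\<^sup>2 \<le> J x" for x
  proof -
    have "0 \<le> (norm x - K)\<^sup>2" by simp
    moreover have "f x \<le> norm x * K" using K[of x] by simp
    ultimately show ?thesis unfolding J_def power2_diff by linarith
  qed
  define m where "m = Inf (range J)"
  have bdd: "bdd_below (range J)" using Jlow by (auto intro!: bdd_belowI)
  have mJ: "m \<le> J x" for x unfolding m_def using bdd by (simp add: cInf_lower)
  have "\<exists>x. J x < m + 1 / Suc n" for n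
    using cInf_less_iff[of "range J" "m + 1 / Suc n"] bdd unfolding m_def by auto
  then obtain X where X: "\<And>n. J (X n) < m + 1 / Suc n" by metis
  have par: "(norm (x - y))\<^sup>2 \<le> 2 * (J x - m) + 2 * (J y - m)" for x y
  proof -
    have "(norm (x - y))\<^sup>2 = 2 * J x + 2 * J y - 4 * J ((1/2) *\<^sub>R (x + y))"
      unfolding J_def power2_norm_eq_inner f.scaleR f.add
      by (simp add: inner_simps inner_commute field_simps)
    then show ?thesis using mJ[of "(1/2) *\<^sub>R (x + y)"] by simp
  qed
  have "Cauchy X"
  proof (rule CauchyI)
    fix e :: real assume e: "0 < e"
    obtain N where N: "4 / e\<^sup>2 < real N" using reals_Archimedean2 by blast
    show "\<exists>M. \<forall>k\<ge>M. \<forall>n\<ge>M. norm (X k - X n) < e"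
    proof (intro exI allI impI)
      fix k n assume k: "N \<le> k" and n: "N \<le> n"
      have N0: "0 < real N" using N e by (smt (verit) divide_pos_pos zero_less_power)
      have "1 / Suc k \<le> 1 / real N" "1 / Suc n \<le> 1 / real N"
        using k n N0 by (auto intro!: divide_left_mono mult_pos_pos)
      then have "(norm (X k - X n))\<^sup>2 < 4 / real N"
        using par[of "X k" "X n"] X[of k] X[of n] by simp
      also have "\<dots> < e\<^sup>2" using N e N0 by (simp add: field_simps)
      finally show "norm (X k - X n) < e" using e by (simp add: power2_less_imp_less)
    qed
  qed
  then obtain y where y: "X \<longlonglongrightarrow> y" using Cauchy_convergent convergent_def by blast
  have "(\<lambda>n. J (X n)) \<longlonglongrightarrow> J y" unfolding J_def
    by (intro tendsto_intros y f.tendsto)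
  moreover have "(\<lambda>n. m + 1 / Suc n) \<longlonglongrightarrow> m + 0"
    by (intro tendsto_intros LIMSEQ_Suc[OF lim_1_over_n])
  ultimately have "J y \<le> m + 0"
    by (rule LIMSEQ_le) (use X in \<open>auto intro: less_imp_le\<close>)
  then have Jy: "J y \<le> J x" for x using mJ[of x] by simp
  have "f x = inner y x" for x
  proof (rule ccontr)
    assume ne: "f x \<noteq> inner y x"
    then have x: "x \<noteq> 0" using f.zero by auto
    define d where "d = inner y x - f x"
    define t where "t = - d / (norm x)\<^sup>2"
    have "J (y + t *\<^sub>R x) = J y + t\<^sup>2 * (norm x)\<^sup>2 + 2 * t * d"
      unfolding J_def d_def power2_norm_eq_inner f.scaleR f.add
      by (simp add: inner_simps inner_commute algebra_simps power2_eq_square)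
    also have "\<dots> = J y - d\<^sup>2 / (norm x)\<^sup>2"
      using x unfolding t_def by (simp add: field_simps power2_eq_square)
    finally have "d\<^sup>2 / (norm x)\<^sup>2 \<le> 0" using Jy[of "y + t *\<^sub>R x"] by simp
    then show False using ne x unfolding d_def
      by (smt (verit, best) divide_pos_pos norm_eq_zero right_minus_eq zero_less_power2)
  qed
  then show ?thesis by blast
qed

lemma bounded_clinearD:
  assumes "bounded_clinear T"
  shows "bounded_linear T" "T (c *\<^sub>C x) = c *\<^sub>C T x" "T (x + y) = T x + T y" "T (x - y) = T x - T y"
    "T 0 = 0" "T (\<Sum>i\<in>A. f i) = (\<Sum>i\<in>A. T (f i))"
  using assms unfolding bounded_clinear_def
  by (auto simp: bounded_linear.linear linear_add linear_diff linear_0 linear_sum)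

lemma bounded_clinearI:
  assumes "\<And>x y. T (x + y) = T x + T y" "\<And>c x. T (c *\<^sub>C x) = c *\<^sub>C T x"
    and "\<And>x. norm (T x) \<le> norm x * K"
  shows "bounded_clinear T"
proof -
  have "T (r *\<^sub>R x) = r *\<^sub>R T x" for r x
    using assms(2)[of "complex_of_real r" x] by (simp add: scaleC_of_real)
  then show ?thesis
    unfolding bounded_clinear_def using assms bounded_linear_intro[of T K] by blast
qed

lemma bounded_clinear_bound:
  assumes "bounded_clinear T"
  obtains K where "0 < K" "\<And>x. norm (T x) \<le> K * norm x"
  using bounded_linear.pos_bounded[OF bounded_clinearD(1)[OF assms]] by (metis mult.commute)

lemma bounded_clinear_compose:
  assumes "bounded_clinear S" "bounded_clinear T"
  shows "bounded_clinear (\<lambda>x. S (T x))"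
  using assms bounded_linear_compose[of S T] unfolding bounded_clinear_def by auto

lemma bounded_clinear_scaleC: "bounded_clinear (\<lambda>x. c *\<^sub>C x)"
  by (rule bounded_clinearI[where K = "cmod c"])
     (auto simp: scaleC_add_right scaleC_scaleC norm_scaleC mult.commute)

lemma bounded_clinear_id: "bounded_clinear (\<lambda>x. x)"
  unfolding bounded_clinear_def by simp

lemma bounded_clinear_zero: "bounded_clinear (\<lambda>x. 0)"
  unfolding bounded_clinear_def by simp

lemma bounded_clinear_add:
  assumes "bounded_clinear S" "bounded_clinear T"
  shows "bounded_clinear (\<lambda>x. S x + T x)"
  using assms bounded_linear_add[of S T] unfolding bounded_clinear_def by (auto simp: scaleC_add_right)

lemma bounded_clinear_diff:
  assumes "bounded_clinear S" "bounded_clinear T"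
  shows "bounded_clinear (\<lambda>x. S x - T x)"
  using assms bounded_linear_sub[of S T] unfolding bounded_clinear_def by (auto simp: complex_vector.scale_right_diff_distrib)

lemma adjoint_unique:
  fixes T :: "'a::chilbert_space \<Rightarrow> 'a"
  assumes "\<And>x y. cinner (A x) y = cinner x (T y)" "\<And>x y. cinner (B x) y = cinner x (T y)"
  shows "A = B"
proof
  fix x
  have "cinner (A x - B x) (A x - B x) = 0"
    using assms by (simp add: cinner_diff_left)
  then show "A x = B x" by (simp add: cinner_self)
qed

lemma adjoint_op:
  assumes T: "bounded_clinear T"
  shows cinner_adjoint_op: "cinner (adjoint_op T x) y = cinner x (T y)"
    and bounded_clinear_adjoint_op: "bounded_clinear (adjoint_op T)"
proof -
  have "\<exists>a. \<forall>y. cinner a y = cinner x (T y)" for x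
  proof -
    have "bounded_linear (\<lambda>y. inner x (T y))"
      by (rule bounded_linear_compose[OF bounded_linear_inner_right bounded_clinearD(1)[OF T]])
    from riesz_representation[OF this] obtain a where a: "\<And>y. inner x (T y) = inner a y"
      by blast
    have "cinner a y = cinner x (T y)" for y
      by (rule cinner_eq_iff_Re)
         (simp_all add: bounded_clinearD(2)[OF T] cinner_scaleC_right a[symmetric] Re_cinner)
    then show ?thesis by blast
  qed
  then obtain A where A: "\<And>x y. cinner (A x) y = cinner x (T y)" by metis
  have adj: "adjoint_op T = A"
    unfolding adjoint_op_def
    by (rule the_equality) (use A adjoint_unique in blast)+
  show "cinner (adjoint_op T x) y = cinner x (T y)" by (simp add: adj A)
  obtain K where K: "0 < K" "\<And>x. norm (T x) \<le> K * norm x" using bounded_clinear_bound[OF T] by blast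
  have eqI: "a = b" if "\<And>y. cinner a y = cinner b y" for a b :: 'a
  proof -
    have "cinner (a - b) (a - b) = 0" using that by (simp add: cinner_diff_left)
    then show ?thesis by (simp add: cinner_self)
  qed
  have "bounded_clinear A"
  proof (rule bounded_clinearI)
    show "A (x + y) = A x + A y" for x y by (rule eqI) (simp add: A cinner_add_left)
    show "A (c *\<^sub>C x) = c *\<^sub>C A x" for c x by (rule eqI) (simp add: A cinner_scaleC_left)
    show "norm (A x) \<le> norm x * K" for x
    proof (cases "A x = 0")
      case False
      have "(norm (A x))\<^sup>2 = inner x (T (A x))"
        using A[of x "A x"] by (metis Re_cinner power2_norm_eq_inner)
      also have "\<dots> \<le> norm x * norm (T (A x))" by (rule norm_cauchy_schwarz)
      also have "\<dots> \<le> norm x * (K * norm (A x))" using K by (simp add: mult_left_mono)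
      finally have "norm (A x) * norm (A x) \<le> (norm x * K) * norm (A x)"
        by (simp add: power2_eq_square mult.assoc)
      then show ?thesis using False by (simp add: mult_le_cancel_right)
    qed (use K in simp)
  qed
  then show "bounded_clinear (adjoint_op T)" by (simp add: adj)
qed

section \<open>Compact operators\<close>

lemma compact_closure_iff_totally_bounded:
  fixes A :: "'a::{metric_space, complete_space} set"
  shows "compact (closure A) \<longleftrightarrow> (\<forall>\<epsilon>>0. \<exists>K. finite K \<and> A \<subseteq> (\<Union>y\<in>K. ball y \<epsilon>))" (is "_ = ?tb A")
proof
  assume "compact (closure A)"
  then have "?tb (closure A)" by (simp add: compact_eq_totally_bounded)
  then show "?tb A" using closure_subset[of A] by (meson order_trans)
next
  assume A: "?tb A"
  have "\<exists>K. finite K \<and> closure A \<subseteq> (\<Union>y\<in>K. ball y \<epsilon>)" if \<epsilon>: "\<epsilon> > 0" for \<epsilon>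
  proof -
    have "0 < \<epsilon> / 2" using \<epsilon> by simp
    then obtain K where K: "finite K" "A \<subseteq> (\<Union>y\<in>K. ball y (\<epsilon>/2))" using A by blast
    have "A \<subseteq> (\<Union>y\<in>K. cball y (\<epsilon>/2))"
      using K(2) by (rule order_trans) (intro UN_mono order_refl ball_subset_cball)
    moreover have "closed (\<Union>y\<in>K. cball y (\<epsilon>/2))" using K(1) by (intro closed_UN) auto
    ultimately have "closure A \<subseteq> (\<Union>y\<in>K. cball y (\<epsilon>/2))" by (rule closure_minimal)
    also have "\<dots> \<subseteq> (\<Union>y\<in>K. ball y \<epsilon>)" using \<epsilon> by (intro UN_mono) auto
    finally show ?thesis using K(1) by blast
  qed
  then show "compact (closure A)"
    unfolding compact_eq_totally_bounded by (simp add: complete_eq_closed)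
qed

lemma compact_op_bounded_clinear: "compact_op T \<Longrightarrow> bounded_clinear T"
  by (simp add: compact_op_def)

lemma compact_opE:
  assumes "compact_op T" "0 < \<epsilon>"
  obtains K where "finite K" "\<And>x. norm x \<le> 1 \<Longrightarrow> \<exists>y\<in>K. norm (T x - y) < \<epsilon>"
proof -
  obtain K where K: "finite K" "T ` cball 0 1 \<subseteq> (\<Union>y\<in>K. ball y \<epsilon>)"
    using assms unfolding compact_op_def compact_closure_iff_totally_bounded by blast
  have "\<exists>y\<in>K. norm (T x - y) < \<epsilon>" if "norm x \<le> 1" for x
  proof -
    have "T x \<in> (\<Union>y\<in>K. ball y \<epsilon>)" using that by (intro subsetD[OF K(2)] imageI) simp
    then show ?thesis by (auto simp: dist_norm norm_minus_commute)
  qed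
  then show ?thesis using that K(1) by blast
qed

lemma compact_opI:
  assumes "bounded_clinear T"
    and "\<And>\<epsilon>. 0 < \<epsilon> \<Longrightarrow> \<exists>K. finite K \<and> (\<forall>x. norm x \<le> 1 \<longrightarrow> (\<exists>y\<in>K. norm (T x - y) < \<epsilon>))"
  shows "compact_op T"
proof -
  have "\<exists>K. finite K \<and> T ` cball 0 1 \<subseteq> (\<Union>y\<in>K. ball y \<epsilon>)" if \<epsilon>: "0 < \<epsilon>" for \<epsilon>
  proof -
    obtain K where K: "finite K" "\<And>x. norm x \<le> 1 \<Longrightarrow> \<exists>y\<in>K. norm (T x - y) < \<epsilon>"
      using assms(2)[OF \<epsilon>] by blast
    have "T ` cball 0 1 \<subseteq> (\<Union>y\<in>K. ball y \<epsilon>)"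
      using K(2) by (force simp: dist_norm norm_minus_commute)
    then show ?thesis using K(1) by blast
  qed
  then show ?thesis
    using assms(1) by (simp add: compact_op_def compact_closure_iff_totally_bounded)
qed

lemma compact_op_zero: "compact_op (\<lambda>x. 0)"
  by (rule compact_opI[OF bounded_clinear_zero]) (auto intro!: exI[of _ "{0}"])

lemma compact_op_add:
  assumes S: "compact_op S" and T: "compact_op T"
  shows "compact_op (\<lambda>x. S x + T x)"
proof (rule compact_opI)
  show "bounded_clinear (\<lambda>x. S x + T x)"
    by (rule bounded_clinear_add[OF assms[THEN compact_op_bounded_clinear]])
next
  fix \<epsilon> :: real assume "0 < \<epsilon>"
  then have \<epsilon>: "0 < \<epsilon> / 2" by simp
  obtain K where K: "finite K" "\<And>x. norm x \<le> 1 \<Longrightarrow> \<exists>y\<in>K. norm (S x - y) < \<epsilon>/2"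
    using compact_opE[OF S \<epsilon>] by blast
  obtain L where L: "finite L" "\<And>x. norm x \<le> 1 \<Longrightarrow> \<exists>y\<in>L. norm (T x - y) < \<epsilon>/2"
    using compact_opE[OF T \<epsilon>] by blast
  have "\<exists>y\<in>(\<lambda>(a, b). a + b) ` (K \<times> L). norm (S x + T x - y) < \<epsilon>" if x: "norm x \<le> 1" for x
  proof -
    obtain a b where ab: "a \<in> K" "norm (S x - a) < \<epsilon>/2" "b \<in> L" "norm (T x - b) < \<epsilon>/2"
      using K(2)[OF x] L(2)[OF x] by blast
    have "norm (S x + T x - (a + b)) < \<epsilon>"
      using norm_diff_triangle_ineq[of "S x" "T x" a b] ab by linarith
    then show ?thesis using ab by (auto intro!: bexI[of _ "(a, b)"])
  qed
  then show "\<exists>K. finite K \<and> (\<forall>x. norm x \<le> 1 \<longrightarrow> (\<exists>y\<in>K. norm (S x + T x - y) < \<epsilon>))"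
    using K(1) L(1) by (intro exI[of _ "(\<lambda>(a, b). a + b) ` (K \<times> L)"]) auto
qed

lemma compact_op_compose_left:
  assumes A: "bounded_clinear A" and T: "compact_op T"
  shows "compact_op (\<lambda>x. A (T x))"
proof (rule compact_opI)
  show "bounded_clinear (\<lambda>x. A (T x))"
    by (rule bounded_clinear_compose[OF A compact_op_bounded_clinear[OF T]])
next
  fix \<epsilon> :: real assume \<epsilon>: "0 < \<epsilon>"
  obtain M where M: "0 < M" "\<And>x. norm (A x) \<le> M * norm x" using bounded_clinear_bound[OF A] by blast
  have "0 < \<epsilon> / M" using \<epsilon> M by simp
  then obtain K where K: "finite K" "\<And>x. norm x \<le> 1 \<Longrightarrow> \<exists>y\<in>K. norm (T x - y) < \<epsilon>/M"
    using compact_opE[OF T] by blast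
  have "\<exists>y\<in>A ` K. norm (A (T x) - y) < \<epsilon>" if x: "norm x \<le> 1" for x
  proof -
    obtain a where a: "a \<in> K" "norm (T x - a) < \<epsilon>/M" using K(2)[OF x] by blast
    have "norm (A (T x) - A a) \<le> M * norm (T x - a)"
      using M(2)[of "T x - a"] by (simp add: bounded_clinearD(4)[OF A])
    also have "\<dots> < \<epsilon>" using a(2) M(1) by (simp add: field_simps)
    finally show ?thesis using a(1) by blast
  qed
  then show "\<exists>K. finite K \<and> (\<forall>x. norm x \<le> 1 \<longrightarrow> (\<exists>y\<in>K. norm (A (T x) - y) < \<epsilon>))"
    using K(1) by (intro exI[of _ "A ` K"]) auto
qed

lemma compact_op_compose_right:
  assumes B: "bounded_clinear B" and T: "compact_op T"
  shows "compact_op (\<lambda>x. T (B x))"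
proof (rule compact_opI)
  show "bounded_clinear (\<lambda>x. T (B x))"
    by (rule bounded_clinear_compose[OF compact_op_bounded_clinear[OF T] B])
next
  fix \<epsilon> :: real assume \<epsilon>: "0 < \<epsilon>"
  obtain M where M: "0 < M" "\<And>x. norm (B x) \<le> M * norm x" using bounded_clinear_bound[OF B] by blast
  have T': "bounded_linear T" using T by (intro bounded_clinearD compact_op_bounded_clinear)
  have "0 < \<epsilon> / M" using \<epsilon> M by simp
  then obtain K where K: "finite K" "\<And>x. norm x \<le> 1 \<Longrightarrow> \<exists>y\<in>K. norm (T x - y) < \<epsilon>/M"
    using compact_opE[OF T] by blast
  have "\<exists>y\<in>(*\<^sub>R) M ` K. norm (T (B x) - y) < \<epsilon>" if x: "norm x \<le> 1" for x
  proof -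
    have "norm (B x) \<le> M" using M(2)[of x] M(1) x by (smt (verit) mult_left_le)
    then have "norm (B x /\<^sub>R M) \<le> 1" using M(1) by (simp add: field_simps)
    then obtain a where a: "a \<in> K" "norm (T (B x /\<^sub>R M) - a) < \<epsilon>/M" using K(2) by blast
    have "T (B x) - M *\<^sub>R a = M *\<^sub>R (T (B x /\<^sub>R M) - a)"
      using M(1) by (simp add: linear_scale[OF bounded_linear.linear[OF T']] scaleR_diff_right)
    then have "norm (T (B x) - M *\<^sub>R a) = M * norm (T (B x /\<^sub>R M) - a)" using M(1) by simp
    then have "norm (T (B x) - M *\<^sub>R a) < \<epsilon>" using a(2) M(1) by (simp add: field_simps)
    then show ?thesis using a(1) by blast
  qed
  then show "\<exists>K. finite K \<and> (\<forall>x. norm x \<le> 1 \<longrightarrow> (\<exists>y\<in>K. norm (T (B x) - y) < \<epsilon>))"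
    using K(1) by (intro exI[of _ "(*\<^sub>R) M ` K"]) auto
qed

text \<open>
  A finite \<open>\<epsilon>/2\<close>-net for the image of the ball under an \<open>\<epsilon>/2\<close>-close compact operator is an \<open>\<epsilon>\<close>-net
  for the image under the limit.
\<close>

lemma compact_op_limit:
  assumes L: "bounded_clinear L"
    and approx: "\<And>\<epsilon>. 0 < \<epsilon> \<Longrightarrow> \<exists>T. compact_op T \<and> (\<forall>x. norm (L x - T x) \<le> \<epsilon> * norm x)"
  shows "compact_op L"
proof (rule compact_opI[OF L])
  fix \<epsilon> :: real assume "0 < \<epsilon>"
  then have \<epsilon>: "0 < \<epsilon> / 2" by simp
  obtain T where T: "compact_op T" "\<And>x. norm (L x - T x) \<le> \<epsilon>/2 * norm x"
    using approx[OF \<epsilon>] by blast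
  obtain K where K: "finite K" "\<And>x. norm x \<le> 1 \<Longrightarrow> \<exists>y\<in>K. norm (T x - y) < \<epsilon>/2"
    using compact_opE[OF T(1) \<epsilon>] by blast
  have "\<exists>y\<in>K. norm (L x - y) < \<epsilon>" if x: "norm x \<le> 1" for x
  proof -
    obtain a where a: "a \<in> K" "norm (T x - a) < \<epsilon>/2" using K(2)[OF x] by blast
    have "\<epsilon>/2 * norm x \<le> \<epsilon>/2" using mult_left_le[OF x, of "\<epsilon>/2"] \<epsilon> by linarith
    then have "norm (L x - a) < \<epsilon>"
      using T(2)[of x] a(2) norm_triangle_ineq[of "L x - T x" "T x - a"] by simp
    then show ?thesis using a(1) by blast
  qed
  then show "\<exists>K. finite K \<and> (\<forall>x. norm x \<le> 1 \<longrightarrow> (\<exists>y\<in>K. norm (L x - y) < \<epsilon>))"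
    using K(1) by blast
qed

section \<open>Gelfand numbers\<close>

text \<open>
  \<open>bounded_off T n c\<close> bounds \<open>T\<close> by \<open>c\<close> on the orthogonal complement of at most \<open>n\<close> vectors.  The
  infimum of such \<open>c\<close> is the \<open>n\<close>-th Gelfand number (counted from 0); these numbers exist for every bounded
  operator, and their behaviour under sums, products and limits can be read off from the definition,
  which is not so for eigenvalues of \<open>T\<^sup>* T\<close>.
\<close>

definition bounded_off :: "('a::chilbert_space \<Rightarrow> 'a) \<Rightarrow> nat \<Rightarrow> real \<Rightarrow> bool"
  where "bounded_off T n c \<longleftrightarrow>
    (\<exists>E. finite E \<and> card E \<le> n \<and> (\<forall>x. (\<forall>e\<in>E. cinner e x = 0) \<longrightarrow> norm (T x) \<le> c * norm x))"

definition gelfand_number :: "('a::chilbert_space \<Rightarrow> 'a) \<Rightarrow> nat \<Rightarrow> real"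
  where "gelfand_number T n = Inf {c. 0 \<le> c \<and> bounded_off T n c}"

lemma bounded_off_mono:
  assumes "bounded_off T n c" "n \<le> m" "c \<le> d"
  shows "bounded_off T m d"
proof -
  have "c * norm x \<le> d * norm x" for x :: 'a using assms(3) by (simp add: mult_right_mono)
  then show ?thesis using assms(1,2) unfolding bounded_off_def by (meson order_trans)
qed

lemma bounded_off_0_iff: "bounded_off T 0 c \<longleftrightarrow> (\<forall>x. norm (T x) \<le> c * norm x)"
  by (auto simp: bounded_off_def)

lemma bounded_off_all:
  assumes "\<And>x. norm (T x) \<le> c * norm x"
  shows "bounded_off T n c"
  using assms bounded_off_mono[of T 0 c n c] by (simp add: bounded_off_0_iff)

lemma gelfand_number_le:
  assumes "bounded_off T n c" "0 \<le> c"
  shows "gelfand_number T n \<le> c"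
  unfolding gelfand_number_def using assms by (intro cInf_lower) (auto intro: bdd_belowI)

lemma gelfand_set_nonempty:
  assumes "bounded_clinear T"
  shows "{c. 0 \<le> c \<and> bounded_off T n c} \<noteq> {}"
proof -
  obtain K where "0 < K" "\<And>x. norm (T x) \<le> K * norm x" using bounded_clinear_bound[OF assms] by blast
  then have "K \<in> {c. 0 \<le> c \<and> bounded_off T n c}" using bounded_off_all[of T K n] by simp
  then show ?thesis by blast
qed

lemma gelfand_number_ge:
  assumes "bounded_clinear T" "\<And>c. 0 \<le> c \<Longrightarrow> bounded_off T n c \<Longrightarrow> r \<le> c"
  shows "r \<le> gelfand_number T n"
  unfolding gelfand_number_def using assms gelfand_set_nonempty[OF assms(1)]
  by (intro cInf_greatest) auto

lemma gelfand_number_nonneg: "bounded_clinear T \<Longrightarrow> 0 \<le> gelfand_number T n"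
  by (rule gelfand_number_ge)

lemma bounded_off_gelfand_number:
  assumes "bounded_clinear T" "gelfand_number T n < c"
  shows "bounded_off T n c"
proof -
  obtain d where "bounded_off T n d" "d < c"
    using cInf_lessD[OF gelfand_set_nonempty[OF assms(1)], of n c] assms(2)
    unfolding gelfand_number_def by auto
  then show ?thesis using bounded_off_mono[of T n d n c] by simp
qed

lemma antimono_gelfand_number:
  assumes "bounded_clinear T"
  shows "antimono (gelfand_number T)"
proof (rule antimonoI)
  fix m n :: nat assume "m \<le> n"
  then show "gelfand_number T n \<le> gelfand_number T m"
    by (intro gelfand_number_ge[OF assms] gelfand_number_le) (auto intro: bounded_off_mono)
qed

section \<open>Eigenvectors of \<open>T\<^sup>* T\<close>\<close>

abbreviation singular_space :: "('a::chilbert_space \<Rightarrow> 'a) \<Rightarrow> real \<Rightarrow> 'a set"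
  where "singular_space T r \<equiv> eigenspace (adjoint_op T \<circ> T) (complex_of_real (r\<^sup>2))"

lemma cinner_singular_space:
  assumes "bounded_clinear T" "x \<in> singular_space T r"
  shows "cinner (T x) (T y) = complex_of_real (r\<^sup>2) * cinner x y"
proof -
  have "cinner (T x) (T y) = cinner (adjoint_op T (T x)) y"
    by (simp add: cinner_adjoint_op[OF assms(1)])
  also have "\<dots> = complex_of_real (r\<^sup>2) * cinner x y"
    using assms(2) by (simp add: eigenspace_def cinner_scaleC_left)
  finally show ?thesis .
qed

lemma norm_singular_space:
  assumes "bounded_clinear T" "x \<in> singular_space T r" "0 \<le> r"
  shows "norm (T x) = r * norm x"
proof -
  have "complex_of_real ((norm (T x))\<^sup>2) = complex_of_real ((r * norm x)\<^sup>2)"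
    using cinner_singular_space[OF assms(1,2), of x] unfolding cinner_self
    by (simp add: power_mult_distrib)
  then show ?thesis using assms(3) by (metis mult_nonneg_nonneg norm_ge_zero of_real_eq_iff power2_eq_iff_nonneg)
qed

lemma singular_space_orthogonal:
  assumes T: "bounded_clinear T" and "x \<in> singular_space T r" "y \<in> singular_space T r'"
    and "0 \<le> r" "0 \<le> r'" "r \<noteq> r'"
  shows "cinner x y = 0"
proof -
  have "complex_of_real (r\<^sup>2) * cinner x y = cnj (cinner (T y) (T x))"
    using cinner_singular_space[OF T assms(2), of y] cinner_commute[of "T x" "T y"] by simp
  also have "\<dots> = complex_of_real (r'\<^sup>2) * cinner x y"
    using cinner_singular_space[OF T assms(3), of x] cinner_commute[of x y] by simp
  finally have "complex_of_real (r\<^sup>2 - r'\<^sup>2) * cinner x y = 0" by (simp add: algebra_simps)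
  moreover have "r\<^sup>2 - r'\<^sup>2 \<noteq> 0" using assms(4-6) by (simp add: power2_eq_iff_nonneg)
  ultimately show ?thesis by (metis mult_eq_0_iff of_real_eq_0_iff)
qed

lemma subspace_singular_space:
  assumes "bounded_clinear T"
  shows "complex_vector.subspace (singular_space T r)"
proof -
  note A = bounded_clinear_compose[OF bounded_clinear_adjoint_op[OF assms] assms]
  show ?thesis
    unfolding complex_vector.subspace_def eigenspace_def
    by (auto simp: bounded_clinearD(2,3,5)[OF A] scaleC_add_right scaleC_scaleC mult.commute)
qed

definition orthonormal :: "'a::chilbert_space set \<Rightarrow> bool"
  where "orthonormal B \<longleftrightarrow> (\<forall>b\<in>B. norm b = 1) \<and> (\<forall>b\<in>B. \<forall>b'\<in>B. b \<noteq> b' \<longrightarrow> cinner b b' = 0)"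

text \<open>
  For a unit vector \<open>b\<close> in \<open>singular_space T r\<close> with \<open>0 < r\<close> the value \<open>r\<close> is \<open>norm (T b)\<close>, so that the
  singular values need not be carried along with the vectors.
\<close>

definition singular_vectors :: "('a::chilbert_space \<Rightarrow> 'a) \<Rightarrow> 'a set \<Rightarrow> bool"
  where "singular_vectors T B \<longleftrightarrow>
    orthonormal B \<and> (\<forall>b\<in>B. 0 < norm (T b) \<and> b \<in> singular_space T (norm (T b)))"

lemma singular_vectorsI:
  assumes "\<And>b. b \<in> B \<Longrightarrow> norm b = 1" "\<And>b b'. b \<in> B \<Longrightarrow> b' \<in> B \<Longrightarrow> b \<noteq> b' \<Longrightarrow> cinner b b' = 0"
    and "\<And>b. b \<in> B \<Longrightarrow> 0 < norm (T b)" "\<And>b. b \<in> B \<Longrightarrow> b \<in> singular_space T (norm (T b))"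
  shows "singular_vectors T B"
  unfolding singular_vectors_def orthonormal_def using assms by (intro conjI ballI impI)

lemma singular_vectorsD:
  assumes "singular_vectors T B" "b \<in> B"
  shows "norm b = 1" "b' \<in> B \<Longrightarrow> b \<noteq> b' \<Longrightarrow> cinner b b' = 0"
    and "0 < norm (T b)" "b \<in> singular_space T (norm (T b))"
  using assms by (simp_all add: singular_vectors_def orthonormal_def)

lemma orthonormal_subset: "orthonormal B \<Longrightarrow> A \<subseteq> B \<Longrightarrow> orthonormal A"
  by (simp add: orthonormal_def subset_iff)

lemma cinner_orthonormal_sum:
  assumes "orthonormal B" "finite B" "c \<in> B"
  shows "cinner c (\<Sum>b\<in>B. u b *\<^sub>C b) = u c"
proof -
  have "cinner c (\<Sum>b\<in>B. u b *\<^sub>C b) = (\<Sum>b\<in>B. u b * cinner c b)"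
    by (simp add: cinner_sum_right cinner_scaleC_right)
  also have "\<dots> = (\<Sum>b\<in>B. if b = c then u c else 0)"
    using assms(1,3) unfolding orthonormal_def by (intro sum.cong) (auto simp: cinner_self)
  finally show ?thesis using assms(2,3) by simp
qed

lemma orthonormal_independent:
  assumes "orthonormal B" "finite B"
  shows "complex_vector.independent B"
proof
  assume "complex_vector.dependent B"
  then obtain u v where u: "v \<in> B" "u v \<noteq> 0" "(\<Sum>b\<in>B. u b *\<^sub>C b) = 0"
    unfolding complex_vector.dependent_finite[OF assms(2)] by blast
  then show False
    using cinner_orthonormal_sum[OF assms u(1), of u] by (simp add: cinner_zero_right)
qed

lemma norm_sum_orthogonal:
  fixes f :: "'b \<Rightarrow> 'a::chilbert_space"
  assumes "finite B" "\<And>b b'. b \<in> B \<Longrightarrow> b' \<in> B \<Longrightarrow> b \<noteq> b' \<Longrightarrow> cinner (f b) (f b') = 0"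
  shows "(norm (\<Sum>b\<in>B. u b *\<^sub>C f b))\<^sup>2 = (\<Sum>b\<in>B. (cmod (u b))\<^sup>2 * (norm (f b))\<^sup>2)"
proof -
  have "pairwise (\<lambda>i j. orthogonal (u i *\<^sub>C f i) (u j *\<^sub>C f j)) B"
    unfolding pairwise_def orthogonal_def
    using assms(2) by (simp add: inner_eq_Re_cinner cinner_scaleC_left cinner_scaleC_right)
  then show ?thesis
    by (simp add: norm_sum_Pythagorean[OF assms(1)] norm_scaleC power_mult_distrib)
qed

text \<open>
  \<open>T\<close> maps distinct singular vectors to orthogonal vectors, so the images of those with
  \<open>\<rho> \<le> norm (T b)\<close> have pairwise distance at least \<open>\<rho>\<close>, and no two of them share a point of a finite \<open>\<rho>/2\<close>-net.
\<close>

lemma finite_large_singular_vectors: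
  assumes T: "compact_op T" and B: "singular_vectors T B" and \<rho>: "0 < \<rho>"
  shows "finite {b \<in> B. \<rho> \<le> norm (T b)}" (is "finite ?F")
proof -
  note T' = compact_op_bounded_clinear[OF T]
  have "0 < \<rho> / 2" using \<rho> by simp
  then obtain K where K: "finite K" "\<And>x. norm x \<le> 1 \<Longrightarrow> \<exists>y\<in>K. norm (T x - y) < \<rho>/2"
    using compact_opE[OF T] by blast
  have "\<forall>b\<in>?F. \<exists>y\<in>K. norm (T b - y) < \<rho>/2"
    using K(2) singular_vectorsD(1)[OF B] by simp
  then obtain g where g: "\<And>b. b \<in> ?F \<Longrightarrow> g b \<in> K \<and> norm (T b - g b) < \<rho>/2" by metis
  have "inj_on g ?F"
  proof (rule inj_onI, rule ccontr)
    fix b c assume b: "b \<in> ?F" and c: "c \<in> ?F" and eq: "g b = g c" and ne: "b \<noteq> c"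
    have small: "norm (T b - T c) < \<rho>"
      using g[OF b] g[OF c] eq norm_triangle_ineq4[of "T b - g b" "T c - g c"] by simp
    have "cinner (T b) (T c) = 0"
      using b c cinner_singular_space[OF T' singular_vectorsD(4)[OF B], of b c]
        singular_vectorsD(2)[OF B _ _ ne] by simp
    then have "(norm (T b - T c))\<^sup>2 = (norm (T b))\<^sup>2 + (norm (T c))\<^sup>2"
      using inner_eq_Re_cinner[of "T b" "T c"]
      by (simp add: power2_norm_eq_inner inner_diff inner_commute)
    moreover have "\<rho>\<^sup>2 \<le> (norm (T b))\<^sup>2" using b \<rho> by (simp add: power_mono)
    moreover have "(norm (T b - T c))\<^sup>2 < \<rho>\<^sup>2" using small by (simp add: power_strict_mono)
    ultimately show False using zero_le_power2[of "norm (T c)"] by linarith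
  qed
  then show ?thesis using K(1) g by (intro inj_on_finite[of g ?F K]) auto
qed

text \<open>
  Zorn's lemma: a nonzero vector of a singular space that is orthogonal to all chosen vectors could be
  normalised and added to them.
\<close>

lemma ex_maximal_singular_vectors:
  assumes T: "bounded_clinear T"
  obtains B where "singular_vectors T B"
    "\<And>r x. 0 < r \<Longrightarrow> x \<in> singular_space T r \<Longrightarrow> (\<And>b. b \<in> B \<Longrightarrow> cinner b x = 0) \<Longrightarrow> x = 0"
proof -
  let ?A = "{B. singular_vectors T B}"
  have "\<Union>C \<in> ?A" if C: "subset.chain ?A C" for C
  proof -
    have sv: "singular_vectors T X" if "X \<in> C" for X
      using C that unfolding subset_chain_def by blast
    have "singular_vectors T (\<Union>C)"
    proof (rule singular_vectorsI)
      fix b c assume bc: "b \<in> \<Union>C" "c \<in> \<Union>C" "b \<noteq> c"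
      obtain X Y where XY: "X \<in> C" "Y \<in> C" "b \<in> X" "c \<in> Y" using bc by blast
      then have "X \<subseteq> Y \<or> Y \<subseteq> X" using C unfolding subset_chain_def by blast
      then obtain Z where "Z \<in> C" "b \<in> Z" "c \<in> Z" using XY by blast
      then show "cinner b c = 0" using singular_vectorsD(2)[OF sv _ _ bc(3)] by auto
    next
      fix b assume "b \<in> \<Union>C"
      then obtain X where "X \<in> C" "b \<in> X" by blast
      then show "norm b = 1" "0 < norm (T b)" "b \<in> singular_space T (norm (T b))"
        using singular_vectorsD(1,3,4)[OF sv] by auto
    qed
    then show ?thesis by simp
  qed
  then have "\<exists>U\<in>?A. \<forall>X\<in>C. X \<subseteq> U" if "subset.chain ?A C" for C
    using that by (intro bexI[of _ "\<Union>C"]) auto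
  from subset_Zorn[OF this] obtain B where B: "singular_vectors T B" and max: "\<And>X. singular_vectors T X \<Longrightarrow> B \<subseteq> X \<Longrightarrow> X = B"
    by auto
  have "x = 0" if r: "0 < r" and x: "x \<in> singular_space T r" and orth: "\<And>b. b \<in> B \<Longrightarrow> cinner b x = 0" for r x
  proof (rule ccontr)
    assume nz: "x \<noteq> 0"
    define y where "y = complex_of_real (1 / norm x) *\<^sub>C x"
    have ny: "norm y = 1" using nz by (simp add: y_def norm_scaleC norm_divide)
    have y: "y \<in> singular_space T r"
      unfolding y_def by (rule complex_vector.subspace_scale[OF subspace_singular_space[OF T] x])
    have Ty: "norm (T y) = r" using norm_singular_space[OF T y] r ny by simp
    have yB: "cinner b y = 0" if "b \<in> B" for b
      using orth[OF that] by (simp add: y_def cinner_scaleC_right)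
    have "singular_vectors T (insert y B)"
      using ny y Ty r yB singular_vectorsD[OF B] by (intro singular_vectorsI) (auto simp: cinner_eq_zero_commute[of y])
    then have "y \<in> B" using max[of "insert y B"] by blast
    then show False using yB[of y] ny by (simp add: cinner_self)
  qed
  then show ?thesis using that B by blast
qed

text \<open>
  Subtracting from \<open>x\<close> its projection to the chosen vectors of value \<open>r\<close> leaves a vector of the same
  singular space that is orthogonal to all chosen vectors, because spaces for different values are
  orthogonal.  So the remainder vanishes and the chosen vectors are a basis.
\<close>

lemma dim_singular_space:
  assumes T: "compact_op T" and B: "singular_vectors T B" and r: "0 < r"
    and max: "\<And>x. x \<in> singular_space T r \<Longrightarrow> (\<And>b. b \<in> B \<Longrightarrow> cinner b x = 0) \<Longrightarrow> x = 0"
  shows "complex_vector.dim (singular_space T r) = card {b \<in> B. norm (T b) = r}" (is "_ = card ?B")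
proof -
  note T' = compact_op_bounded_clinear[OF T]
  have fin: "finite ?B"
    by (rule finite_subset[OF _ finite_large_singular_vectors[OF T B r]]) auto
  have on: "orthonormal ?B"
    by (rule orthonormal_subset[of B]) (use B in \<open>simp_all add: singular_vectors_def\<close>)
  have sub: "?B \<subseteq> singular_space T r" using singular_vectorsD(4)[OF B] by blast
  have "x \<in> complex_vector.span ?B" if x: "x \<in> singular_space T r" for x
  proof -
    let ?p = "\<Sum>b\<in>?B. cinner b x *\<^sub>C b"
    have p: "?p \<in> complex_vector.span ?B"
      by (intro complex_vector.span_sum complex_vector.span_scale complex_vector.span_base)
    then have "?p \<in> singular_space T r"
      using complex_vector.span_minimal[OF sub subspace_singular_space[OF T']] by blast
    then have xp: "x - ?p \<in> singular_space T r"
      by (rule complex_vector.subspace_diff[OF subspace_singular_space[OF T'] x])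
    have "x - ?p = 0"
    proof (rule max[OF xp])
      fix b assume b: "b \<in> B"
      show "cinner b (x - ?p) = 0"
      proof (cases "norm (T b) = r")
        case True
        then show ?thesis using cinner_orthonormal_sum[OF on fin, of b "\<lambda>b. cinner b x"] b
          by (simp add: cinner_diff_right)
      next
        case False
        then show ?thesis using r
          by (intro singular_space_orthogonal[OF T' singular_vectorsD(4)[OF B b] xp]) auto
      qed
    qed
    then show ?thesis using p by simp
  qed
  then have "complex_vector.span ?B = singular_space T r"
    using complex_vector.span_minimal[OF sub subspace_singular_space[OF T']] by blast
  then have "complex_vector.span ?B = complex_vector.span (singular_space T r)"
    by (metis complex_vector.span_span)
  then show ?thesis
    by (rule complex_vector.dim_eq_card[OF _ orthonormal_independent[OF on fin]])
qed

section \<open>The min-max principle\<close>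

text \<open>
  Gaussian elimination: an equation with a nonzero coefficient at \<open>c\<close> is used to eliminate the unknown
  \<open>u c\<close> from the others.
\<close>

lemma homogeneous_system_nontrivial_solution:
  fixes f :: "'e \<Rightarrow> 'b \<Rightarrow> 'k::field"
  assumes "finite E" "finite B" "card E < card B"
  shows "\<exists>u. (\<exists>b\<in>B. u b \<noteq> 0) \<and> (\<forall>e\<in>E. (\<Sum>b\<in>B. u b * f e b) = 0)"
  using assms
proof (induction E arbitrary: B f rule: finite_induct)
  case empty
  then have "B \<noteq> {}" by auto
  then show ?case by (auto intro!: exI[of _ "\<lambda>_. 1"])
next
  case (insert e E)
  show ?case
  proof (cases "\<forall>b\<in>B. f e b = 0")
    case True
    have "card E < card B" using insert by simp
    from insert.IH[OF insert.prems(1) this, of f] show ?thesis using True by auto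
  next
    case False
    then obtain c where c: "c \<in> B" "f e c \<noteq> 0" by blast
    have "card E < card (B - {c})" using insert c by simp
    from insert.IH[OF _ this, of "\<lambda>e' b. f e' b - f e b / f e c * f e' c"] insert.prems(1)
    obtain u where u: "\<exists>b\<in>B - {c}. u b \<noteq> 0"
      "\<And>e'. e' \<in> E \<Longrightarrow> (\<Sum>b\<in>B - {c}. u b * (f e' b - f e b / f e c * f e' c)) = 0"
      by auto
    define v where "v = u(c := - (\<Sum>b\<in>B - {c}. u b * f e b) / f e c)"
    have split: "(\<Sum>b\<in>B. v b * f e' b) =
        (\<Sum>b\<in>B - {c}. u b * f e' b) - (\<Sum>b\<in>B - {c}. u b * f e b) / f e c * f e' c" for e'
      using insert.prems(1) c(1) by (simp add: sum.remove[of B c] v_def)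
    have "(\<Sum>b\<in>B. v b * f e b) = 0" using c(2) by (simp add: split)
    moreover have "(\<Sum>b\<in>B. v b * f e' b) = 0" if "e' \<in> E" for e'
      using u(2)[OF that]
      by (simp add: split right_diff_distrib sum_subtractf sum_distrib_right sum_divide_distrib mult.assoc)
    moreover have "\<exists>b\<in>B. v b \<noteq> 0" using u(1) by (auto simp: v_def)
    ultimately show ?thesis by (intro exI[of _ v]) auto
  qed
qed

text \<open>
  The lower bound for Gelfand numbers: a subspace of dimension greater than \<open>n\<close> contains a nonzero
  vector orthogonal to any given \<open>n\<close> vectors, and on the span of \<open>F\<close> the operator \<open>T\<close> stretches by at
  least \<open>\<rho>\<close>.
\<close>

lemma singular_vectors_le_bound:
  assumes T: "bounded_clinear T" and B: "singular_vectors T B"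
    and F: "F \<subseteq> B" "finite F" "n < card F" "\<And>b. b \<in> F \<Longrightarrow> \<rho> \<le> norm (T b)"
    and \<rho>: "0 \<le> \<rho>" and c: "bounded_off T n c"
  shows "\<rho> \<le> c"
proof -
  obtain E where E: "finite E" "card E \<le> n"
    "\<And>x. (\<And>e. e \<in> E \<Longrightarrow> cinner e x = 0) \<Longrightarrow> norm (T x) \<le> c * norm x"
    using c unfolding bounded_off_def by blast
  have "card E < card F" using E F by simp
  from homogeneous_system_nontrivial_solution[OF E(1) F(2) this, of cinner]
  obtain u where u: "\<exists>b\<in>F. u b \<noteq> 0" "\<And>e. e \<in> E \<Longrightarrow> (\<Sum>b\<in>F. u b * cinner e b) = 0"
    by blast
  define x where "x = (\<Sum>b\<in>F. u b *\<^sub>C b)"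
  have on: "b \<in> F \<Longrightarrow> norm b = 1" "b \<in> F \<Longrightarrow> b' \<in> F \<Longrightarrow> b \<noteq> b' \<Longrightarrow> cinner b b' = 0" for b b'
    using singular_vectorsD(1,2)[OF B] F(1) by blast+
  have nx: "(norm x)\<^sup>2 = (\<Sum>b\<in>F. (cmod (u b))\<^sup>2)"
    unfolding x_def using norm_sum_orthogonal[OF F(2), of "\<lambda>b. b" u] on by simp
  have "T x = (\<Sum>b\<in>F. u b *\<^sub>C T b)"
    unfolding x_def by (simp add: bounded_clinearD[OF T])
  moreover have "cinner (T b) (T b') = 0" if "b \<in> F" "b' \<in> F" "b \<noteq> b'" for b b'
    using cinner_singular_space[OF T singular_vectorsD(4)[OF B], of b b'] on(2)[OF that] F(1) that(1)
    by auto
  ultimately have "(norm (T x))\<^sup>2 = (\<Sum>b\<in>F. (cmod (u b))\<^sup>2 * (norm (T b))\<^sup>2)"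
    using norm_sum_orthogonal[OF F(2), of T u] by simp
  also have "\<dots> \<ge> (\<Sum>b\<in>F. (cmod (u b))\<^sup>2 * \<rho>\<^sup>2)"
    using F(4) \<rho> by (intro sum_mono mult_left_mono power_mono) auto
  finally have "(\<rho> * norm x)\<^sup>2 \<le> (norm (T x))\<^sup>2"
    by (simp add: nx power_mult_distrib sum_distrib_left mult.commute)
  then have "\<rho> * norm x \<le> norm (T x)" by (rule power2_le_imp_le) simp
  also have "\<dots> \<le> c * norm x"
    by (rule E(3)) (use u(2) in \<open>simp add: x_def cinner_sum_right cinner_scaleC_right\<close>)
  finally have *: "\<rho> * norm x \<le> c * norm x" .
  have "(norm x)\<^sup>2 > 0"
  proof -
    obtain b where "b \<in> F" "u b \<noteq> 0" using u(1) by blast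
    then show ?thesis unfolding nx using F(2) by (intro sum_pos2[of F b]) simp_all
  qed
  then show ?thesis using * by (simp add: mult_le_cancel_right)
qed

text \<open>
  The upper bound for Gelfand numbers: the norm \<open>\<mu>\<close> of \<open>T\<close> on the orthogonal complement \<open>M\<close> of \<open>E\<close>, if
  positive, is itself a singular value, with a singular vector in \<open>M\<close>.  The complement is invariant under \<open>A = T\<^sup>* T\<close>
  because \<open>E\<close> consists of eigenvectors.  For \<open>x n\<close> in the unit ball of \<open>M\<close> with \<open>norm (T (x n))\<close> tending to
  \<open>\<mu>\<close>, the residual satisfies \<open>(norm (A x - \<mu>\<^sup>2 x))\<^sup>2 \<le> \<mu>\<^sup>2 (\<mu>\<^sup>2 - (norm (T x))\<^sup>2)\<close> and tends to 0; by
  compactness \<open>A (x n)\<close> converges along a subsequence, hence so does \<open>x n\<close>, to an eigenvector.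
\<close>

lemma norm_attained_off_singular_vectors:
  assumes T: "compact_op T" and E: "\<And>e. e \<in> E \<Longrightarrow> \<exists>r. e \<in> singular_space T r"
  obtains \<mu> where "0 \<le> \<mu>" "\<And>x. (\<And>e. e \<in> E \<Longrightarrow> cinner e x = 0) \<Longrightarrow> norm (T x) \<le> \<mu> * norm x"
    "0 < \<mu> \<Longrightarrow> \<exists>x\<in>singular_space T \<mu>. x \<noteq> 0 \<and> (\<forall>e\<in>E. cinner e x = 0)"
proof -
  note T' = compact_op_bounded_clinear[OF T]
  note A' = bounded_clinear_adjoint_op[OF T']
  define M where "M = {x. \<forall>e\<in>E. cinner e x = 0}"
  define A where "A x = adjoint_op T (T x)" for x
  obtain K where K: "0 < K" "\<And>x. norm (T x) \<le> K * norm x" using bounded_clinear_bound[OF T'] by blast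
  let ?V = "(\<lambda>x. norm (T x)) ` (M \<inter> cball 0 1)"
  define \<mu> where "\<mu> = Sup ?V"
  have bdd: "bdd_above ?V"
  proof (rule bdd_aboveI2)
    fix x assume "x \<in> M \<inter> cball 0 1"
    then have "K * norm x \<le> K" using K(1) by (simp add: mult_left_le)
    then show "norm (T x) \<le> K" using K(2)[of x] by linarith
  qed
  have M0: "0 \<in> M \<inter> cball 0 1" by (simp add: M_def cinner_zero_right)
  have \<mu>0: "0 \<le> \<mu>"
    unfolding \<mu>_def by (rule cSup_upper2[OF imageI[OF M0] _ bdd]) simp
  have Mscale: "c *\<^sub>C x \<in> M" if "x \<in> M" for c x using that by (simp add: M_def cinner_scaleC_right)
  have AM: "A x \<in> M" if x: "x \<in> M" for x
    unfolding M_def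
  proof clarify
    fix e assume e: "e \<in> E"
    obtain r where r: "e \<in> singular_space T r" using E[OF e] by blast
    have "cinner e (A x) = cnj (cinner (A x) e)" by (rule cinner_commute)
    also have "\<dots> = cnj (cinner (T x) (T e))" by (simp add: A_def cinner_adjoint_op[OF T'])
    also have "\<dots> = cinner (T e) (T x)" by (rule cinner_commute[symmetric])
    also have "\<dots> = 0" using cinner_singular_space[OF T' r] x e by (simp add: M_def)
    finally show "cinner e (A x) = 0" .
  qed
  have bound: "norm (T x) \<le> \<mu> * norm x" if x: "x \<in> M" for x
  proof (cases "x = 0")
    case False
    let ?y = "complex_of_real (1 / norm x) *\<^sub>C x"
    have "?y \<in> M \<inter> cball 0 1" using Mscale[OF x] False by (simp add: norm_scaleC norm_divide)
    then have "norm (T ?y) \<le> \<mu>" unfolding \<mu>_def by (intro cSup_upper imageI bdd)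
    then show ?thesis using False by (simp add: bounded_clinearD(2)[OF T'] norm_scaleC norm_divide field_simps)
  qed (simp add: bounded_clinearD(5)[OF T'])
  have "\<exists>x\<in>singular_space T \<mu>. x \<noteq> 0 \<and> (\<forall>e\<in>E. cinner e x = 0)" if \<mu>: "0 < \<mu>"
  proof -
    have "\<exists>x\<in>M \<inter> cball 0 1. \<mu> - 1 / Suc n < norm (T x)" for n
    proof -
      have "?V \<noteq> {}" using M0 by blast
      then show ?thesis
        using less_cSup_iff[OF _ bdd, of "\<mu> - 1 / Suc n"] by (auto simp flip: \<mu>_def)
    qed
    then obtain X where "\<And>n. X n \<in> M \<inter> cball 0 1 \<and> \<mu> - 1 / Suc n < norm (T (X n))"
      by metis
    then have X: "X n \<in> M" "norm (X n) \<le> 1" "\<mu> - 1 / Suc n < norm (T (X n))" for n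
      by auto
    have TX: "norm (T (X n)) \<le> \<mu>" for n
      using bound[OF X(1)[of n]] mult_left_le[OF X(2)[of n] \<mu>0] by linarith
    have lim: "(\<lambda>n. norm (T (X n))) \<longlonglongrightarrow> \<mu>"
    proof (rule tendsto_sandwich[of "\<lambda>n. \<mu> - 1 / Suc n" _ _ "\<lambda>_. \<mu>"])
      have "(\<lambda>n. \<mu> - 1 / Suc n) \<longlonglongrightarrow> \<mu> - 0"
        by (intro tendsto_intros LIMSEQ_Suc[OF lim_1_over_n])
      then show "(\<lambda>n. \<mu> - 1 / Suc n) \<longlonglongrightarrow> \<mu>" by simp
    qed (use X(3) TX in \<open>auto intro: always_eventually less_imp_le\<close>)
    have res: "(norm (A (X n) - \<mu>\<^sup>2 *\<^sub>R X n))\<^sup>2 \<le> \<mu>\<^sup>2 * (\<mu>\<^sup>2 - (norm (T (X n)))\<^sup>2)" for n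
    proof -
      let ?x = "X n"
      have AT: "inner (A ?x) y = inner (T ?x) (T y)" for y
        by (simp add: inner_eq_Re_cinner A_def cinner_adjoint_op[OF T'])
      have "(norm (A ?x))\<^sup>2 \<le> norm (T ?x) * norm (T (A ?x))"
        using AT[of "A ?x"] norm_cauchy_schwarz[of "T ?x" "T (A ?x)"] by (simp add: power2_norm_eq_inner)
      also have "\<dots> \<le> norm (T ?x) * (\<mu> * norm (A ?x))"
        using bound[OF AM[OF X(1)]] by (intro mult_left_mono) auto
      finally have "norm (A ?x) * norm (A ?x) \<le> (\<mu> * norm (T ?x)) * norm (A ?x)"
        by (simp add: power2_eq_square mult_ac)
      then have "norm (A ?x) \<le> \<mu> * norm (T ?x)"
        using \<mu>0 by (cases "A ?x = 0") (simp_all add: mult_le_cancel_right)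
      then have "(norm (A ?x))\<^sup>2 \<le> (\<mu> * norm (T ?x))\<^sup>2" by (intro power_mono) auto
      moreover have "(norm (A ?x - \<mu>\<^sup>2 *\<^sub>R ?x))\<^sup>2 =
          (norm (A ?x))\<^sup>2 - 2 * \<mu>\<^sup>2 * (norm (T ?x))\<^sup>2 + (\<mu>\<^sup>2)\<^sup>2 * (norm ?x)\<^sup>2"
      proof -
        have "(norm (A ?x - \<mu>\<^sup>2 *\<^sub>R ?x))\<^sup>2 =
            (norm (A ?x))\<^sup>2 - 2 * \<mu>\<^sup>2 * inner (A ?x) ?x + (\<mu>\<^sup>2)\<^sup>2 * (norm ?x)\<^sup>2"
          unfolding power2_norm_eq_inner inner_diff_left inner_diff_right inner_scaleR_left
            inner_scaleR_right inner_commute[of ?x "A ?x"]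
          by (simp add: power2_eq_square algebra_simps)
        then show ?thesis using AT[of ?x] by (simp add: power2_norm_eq_inner)
      qed
      moreover have "(\<mu>\<^sup>2)\<^sup>2 * (norm ?x)\<^sup>2 \<le> (\<mu>\<^sup>2)\<^sup>2 * 1"
        using X(2)[of n] by (intro mult_left_mono) (auto simp: power_le_one)
      ultimately have "(norm (A ?x - \<mu>\<^sup>2 *\<^sub>R ?x))\<^sup>2 \<le> \<mu>\<^sup>2 * (norm (T ?x))\<^sup>2 - 2 * \<mu>\<^sup>2 * (norm (T ?x))\<^sup>2 + (\<mu>\<^sup>2)\<^sup>2"
        unfolding power_mult_distrib by linarith
      then show ?thesis by (simp add: right_diff_distrib power2_eq_square[of "\<mu>\<^sup>2"])
    qed
    have "(\<lambda>n. \<mu>\<^sup>2 * (\<mu>\<^sup>2 - (norm (T (X n)))\<^sup>2)) \<longlonglongrightarrow> \<mu>\<^sup>2 * (\<mu>\<^sup>2 - \<mu>\<^sup>2)"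
      by (intro tendsto_intros lim)
    then have lim0: "(\<lambda>n. \<mu>\<^sup>2 * (\<mu>\<^sup>2 - (norm (T (X n)))\<^sup>2)) \<longlonglongrightarrow> 0" by simp
    have "(\<lambda>n. (norm (A (X n) - \<mu>\<^sup>2 *\<^sub>R X n))\<^sup>2) \<longlonglongrightarrow> 0"
      by (rule Lim_null_comparison[OF always_eventually lim0]) (use res in simp)
    then have "(\<lambda>n. sqrt ((norm (A (X n) - \<mu>\<^sup>2 *\<^sub>R X n))\<^sup>2)) \<longlonglongrightarrow> sqrt 0"
      by (rule tendsto_real_sqrt)
    then have res0: "(\<lambda>n. A (X n) - \<mu>\<^sup>2 *\<^sub>R X n) \<longlonglongrightarrow> 0"
      by (simp add: tendsto_norm_zero_iff)
    have "T (X n) \<in> closure (T ` cball 0 1)" for n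
      using X(2)[of n] by (intro subsetD[OF closure_subset] imageI) simp
    moreover have "seq_compact (closure (T ` cball 0 1))"
      using T by (intro compact_imp_seq_compact) (simp add: compact_op_def)
    ultimately have "\<exists>y\<in>closure (T ` cball 0 1). \<exists>\<sigma>. strict_mono \<sigma> \<and> ((\<lambda>n. T (X n)) \<circ> \<sigma>) \<longlonglongrightarrow> y"
      unfolding seq_compact_def by (elim allE[of _ "\<lambda>n. T (X n)"]) simp
    then obtain y \<sigma> where \<sigma>: "strict_mono (\<sigma> :: nat \<Rightarrow> nat)" "((\<lambda>n. T (X n)) \<circ> \<sigma>) \<longlonglongrightarrow> y"
      by (elim bexE exE conjE)
    have "(\<lambda>n. adjoint_op T (((\<lambda>n. T (X n)) \<circ> \<sigma>) n)) \<longlonglongrightarrow> adjoint_op T y"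
      by (rule bounded_linear.tendsto[OF bounded_clinearD(1)[OF A'] \<sigma>(2)])
    moreover have "((\<lambda>n. A (X n) - \<mu>\<^sup>2 *\<^sub>R X n) \<circ> \<sigma>) \<longlonglongrightarrow> 0"
      by (rule LIMSEQ_subseq_LIMSEQ[OF res0 \<sigma>(1)])
    ultimately have "(\<lambda>n. (1/\<mu>\<^sup>2) *\<^sub>R (A (X (\<sigma> n)) - (A (X (\<sigma> n)) - \<mu>\<^sup>2 *\<^sub>R X (\<sigma> n))))
        \<longlonglongrightarrow> (1/\<mu>\<^sup>2) *\<^sub>R (adjoint_op T y - 0)"
      unfolding A_def comp_def by (intro tendsto_intros)
    then obtain x where x: "(\<lambda>n. X (\<sigma> n)) \<longlonglongrightarrow> x" using \<mu> by simp
    note contT = bounded_linear.tendsto[OF bounded_clinearD(1)[OF T'] x]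
    have "(\<lambda>n. A (X (\<sigma> n)) - \<mu>\<^sup>2 *\<^sub>R X (\<sigma> n)) \<longlonglongrightarrow> A x - \<mu>\<^sup>2 *\<^sub>R x"
      unfolding A_def
      by (intro tendsto_intros x bounded_linear.tendsto[OF bounded_clinearD(1)[OF A']] contT)
    moreover have "(\<lambda>n. A (X (\<sigma> n)) - \<mu>\<^sup>2 *\<^sub>R X (\<sigma> n)) \<longlonglongrightarrow> 0"
      using LIMSEQ_subseq_LIMSEQ[OF res0 \<sigma>(1)] by (simp add: comp_def)
    ultimately have "A x - \<mu>\<^sup>2 *\<^sub>R x = 0" by (rule LIMSEQ_unique)
    then have "x \<in> singular_space T \<mu>"
      unfolding eigenspace_def mem_Collect_eq scaleC_of_real by (simp add: A_def)
    moreover have "norm (T x) = \<mu>"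
      using LIMSEQ_unique[OF tendsto_norm[OF contT]] LIMSEQ_subseq_LIMSEQ[OF lim \<sigma>(1)]
      by (simp add: comp_def)
    then have "x \<noteq> 0" using \<mu> by (auto simp: bounded_clinearD(5)[OF T'])
    moreover have "cinner e x = 0" if e: "e \<in> E" for e
    proof -
      have ortho: "inner (c *\<^sub>C e) x = 0" for c
      proof -
        have "(\<lambda>n. inner (c *\<^sub>C e) (X (\<sigma> n))) \<longlonglongrightarrow> inner (c *\<^sub>C e) x"
          by (intro tendsto_intros x)
        moreover have "inner (c *\<^sub>C e) (X (\<sigma> n)) = 0" for n
          using X(1)[of "\<sigma> n"] e by (simp add: M_def inner_eq_Re_cinner cinner_scaleC_left)
        ultimately show ?thesis by (simp add: LIMSEQ_const_iff)
      qed
      show ?thesis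
        using ortho[of 1] ortho[of \<i>]
        by (intro complex_eqI) (simp_all add: inner_eq_Re_cinner cinner_scaleC_left)
    qed
    ultimately show ?thesis by blast
  qed
  then show ?thesis using that \<mu>0 bound unfolding M_def by blast
qed

text \<open>
  At the first index where the sequences differ, the level set of the larger value is strictly
  smaller for the other sequence.  The value 0 must be excluded because its level set may be infinite.
\<close>

lemma antimono_eq_if_level_cards_eq:
  fixes s s' :: "nat \<Rightarrow> real"
  assumes s: "antimono s" "\<And>n. 0 \<le> s n" "\<And>r. 0 < r \<Longrightarrow> finite {n. s n = r}"
    and s': "antimono s'" "\<And>n. 0 \<le> s' n" "\<And>r. 0 < r \<Longrightarrow> finite {n. s' n = r}"
    and card: "\<And>r. 0 < r \<Longrightarrow> card {n. s n = r} = card {n. s' n = r}"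
  shows "s = s'"
proof (rule ccontr)
  assume "s \<noteq> s'"
  then have "\<exists>n. s n \<noteq> s' n" by auto
  then obtain n where n: "s n \<noteq> s' n" "\<And>k. k < n \<Longrightarrow> s k = s' k"
    using exists_least_iff[of "\<lambda>n. s n \<noteq> s' n"] by blast
  have *: False if u: "antimono v" "\<And>n. 0 \<le> v n"
    and fin: "\<And>r. 0 < r \<Longrightarrow> finite {n. u n = r}"
    and card: "\<And>r. 0 < r \<Longrightarrow> card {n. u n = r} = card {n. v n = r}"
    and lt: "v n < u n" and eq: "\<And>k. k < n \<Longrightarrow> u k = v k" for u v :: "nat \<Rightarrow> real"
  proof -
    have pos: "0 < u n" using lt u(2)[of n] by linarith
    have "{k. v k = u n} \<subset> {k. u k = u n}"
    proof
      show "{k. v k = u n} \<subseteq> {k. u k = u n}"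
      proof clarify
        fix k assume k: "v k = u n"
        have "k < n"
        proof (rule ccontr)
          assume "\<not> k < n"
          then have "v k \<le> v n" using antimonoD[OF u(1), of n k] by simp
          then show False using k lt by linarith
        qed
        then show "u k = u n" using eq k by simp
      qed
      show "{k. v k = u n} \<noteq> {k. u k = u n}"
        using lt by (auto simp: set_eq_iff intro!: exI[of _ n])
    qed
    then have "card {k. v k = u n} < card {k. u k = u n}"
      by (rule psubset_card_mono[OF fin[OF pos]])
    then show False using card[OF pos] by simp
  qed
  show False
  proof (cases "s n < s' n")
    case True
    show False by (rule *[OF s(1,2) s'(3) card[symmetric] True n(2)[symmetric]])
  next
    case False
    then have "s' n < s n" using n(1) by simp
    show False by (rule *[OF s'(1,2) s(3) card \<open>s' n < s n\<close> n(2)])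
  qed
qed

text \<open>
  With \<open>G\<close> and \<open>G'\<close> the singular vectors of value at least \<open>r\<close> and greater than \<open>r\<close>, the two bounds above
  show that the \<open>n\<close>-th Gelfand number is at least \<open>r\<close> iff \<open>n < card G\<close>, and greater than \<open>r\<close> iff
  \<open>n < card G'\<close>.
\<close>

lemma gelfand_number_levels:
  assumes T: "compact_op T" and r: "0 < r"
  shows "finite {n. gelfand_number T n = r}"
    and "card {n. gelfand_number T n = r} = complex_vector.dim (singular_space T r)"
proof -
  note T' = compact_op_bounded_clinear[OF T]
  obtain B where B: "singular_vectors T B" and
    max: "\<And>r x. 0 < r \<Longrightarrow> x \<in> singular_space T r \<Longrightarrow> (\<And>b. b \<in> B \<Longrightarrow> cinner b x = 0) \<Longrightarrow> x = 0"
    using ex_maximal_singular_vectors[OF T'] by blast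
  define G where "G = {b \<in> B. r \<le> norm (T b)}"
  define G' where "G' = {b \<in> B. r < norm (T b)}"
  have finG: "finite G" unfolding G_def by (rule finite_large_singular_vectors[OF T B r])
  have G'G: "G' \<subseteq> G" by (auto simp: G_def G'_def)
  have finG': "finite G'" using finite_subset[OF G'G finG] .
  have upper: "\<exists>\<mu>\<ge>0. gelfand_number T n \<le> \<mu> \<and> (\<mu> = 0 \<or> (\<exists>b\<in>B - F. norm (T b) = \<mu>))"
    if F: "F \<subseteq> B" "finite F" "card F \<le> n" for F n
  proof -
    have "\<exists>r. e \<in> singular_space T r" if "e \<in> F" for e
      using that F(1) singular_vectorsD(4)[OF B] by blast
    then obtain \<mu> where \<mu>: "0 \<le> \<mu>" "\<And>x. (\<And>e. e \<in> F \<Longrightarrow> cinner e x = 0) \<Longrightarrow> norm (T x) \<le> \<mu> * norm x"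
      "0 < \<mu> \<Longrightarrow> \<exists>x\<in>singular_space T \<mu>. x \<noteq> 0 \<and> (\<forall>e\<in>F. cinner e x = 0)"
      using norm_attained_off_singular_vectors[OF T] by metis
    have "bounded_off T n \<mu>" using \<mu>(2) F unfolding bounded_off_def by blast
    then have "gelfand_number T n \<le> \<mu>" using \<mu>(1) by (rule gelfand_number_le)
    moreover have "\<exists>b\<in>B - F. norm (T b) = \<mu>" if pos: "0 < \<mu>"
    proof -
      obtain x where x: "x \<in> singular_space T \<mu>" "x \<noteq> 0" "\<forall>e\<in>F. cinner e x = 0"
        using \<mu>(3) pos by blast
      obtain b where b: "b \<in> B" "cinner b x \<noteq> 0" using max[OF pos x(1)] x(2) by blast
      have "norm (T b) = \<mu>"
        using singular_space_orthogonal[OF T' singular_vectorsD(4)[OF B b(1)] x(1)] b(2) \<mu>(1) by auto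
      then show ?thesis using b x(3) by blast
    qed
    ultimately show ?thesis using \<mu>(1) by force
  qed
  have lower: "\<rho> \<le> gelfand_number T n"
    if "F \<subseteq> B" "finite F" "n < card F" "\<And>b. b \<in> F \<Longrightarrow> \<rho> \<le> norm (T b)" "0 \<le> \<rho>" for F n \<rho>
    using singular_vectors_le_bound[OF T' B that] by (intro gelfand_number_ge[OF T']) auto
  have ge: "r \<le> gelfand_number T n \<longleftrightarrow> n < card G" for n
  proof
    assume "n < card G"
    then show "r \<le> gelfand_number T n" using r by (intro lower[OF _ finG]) (auto simp: G_def)
  next
    assume r_le: "r \<le> gelfand_number T n"
    show "n < card G"
    proof (rule ccontr)
      assume "\<not> n < card G"
      then have "card G \<le> n" by simp
      then obtain \<mu> where \<mu>: "gelfand_number T n \<le> \<mu>" "\<mu> = 0 \<or> (\<exists>b\<in>B - G. norm (T b) = \<mu>)"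
        using upper[of G n] finG by (auto simp: G_def)
      then have "\<mu> < r" using r by (auto simp: G_def)
      then show False using r_le \<mu>(1) by linarith
    qed
  qed
  have gt: "r < gelfand_number T n \<longleftrightarrow> n < card G'" for n
  proof
    assume n: "n < card G'"
    then have ne: "G' \<noteq> {}" by auto
    (* the least value above r: there are only finitely many of them *)
    define \<rho> where "\<rho> = Min ((\<lambda>b. norm (T b)) ` G')"
    have "r < \<rho>" unfolding \<rho>_def using ne finG' by (auto simp: G'_def)
    also have "\<rho> \<le> gelfand_number T n"
      by (rule lower[OF _ finG' n]) (use finG' \<open>r < \<rho>\<close> r in \<open>auto simp: \<rho>_def G'_def\<close>)
    finally show "r < gelfand_number T n" .
  next
    assume r_less: "r < gelfand_number T n"
    show "n < card G'"
    proof (rule ccontr)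
      assume "\<not> n < card G'"
      then have "card G' \<le> n" by simp
      then obtain \<mu> where \<mu>: "gelfand_number T n \<le> \<mu>" "\<mu> = 0 \<or> (\<exists>b\<in>B - G'. norm (T b) = \<mu>)"
        using upper[of G' n] finG' by (auto simp: G'_def)
      then have "\<mu> \<le> r" using r by (auto simp: G'_def)
      then show False using r_less \<mu>(1) by linarith
    qed
  qed
  have level: "{n. gelfand_number T n = r} = {card G'..<card G}"
  proof (rule set_eqI)
    fix n
    have "gelfand_number T n = r \<longleftrightarrow> r \<le> gelfand_number T n \<and> \<not> r < gelfand_number T n" by auto
    then show "n \<in> {n. gelfand_number T n = r} \<longleftrightarrow> n \<in> {card G'..<card G}"
      unfolding ge gt by auto
  qed
  then show "finite {n. gelfand_number T n = r}" by simp
  have "G - G' = {b \<in> B. norm (T b) = r}" by (auto simp: G_def G'_def)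
  then have "card {n. gelfand_number T n = r} = card {b \<in> B. norm (T b) = r}"
    unfolding level using card_Diff_subset[OF finG' G'G] by simp
  also have "\<dots> = complex_vector.dim (singular_space T r)"
    by (rule dim_singular_space[OF T B r max[OF r], symmetric])
  finally show "card {n. gelfand_number T n = r} = complex_vector.dim (singular_space T r)" .
qed

theorem singular_value_eq_gelfand_number:
  assumes "compact_op T"
  shows "singular_value T = gelfand_number T"
  unfolding singular_value_def
proof (rule the_equality)
  note T' = compact_op_bounded_clinear[OF assms]
  let ?P = "\<lambda>s::nat \<Rightarrow> real. antimono s \<and> (\<forall>n. 0 \<le> s n) \<and>
    (\<forall>r>0. finite {n. s n = r} \<and> card {n. s n = r} = complex_vector.dim (singular_space T r))"
  show g: "?P (gelfand_number T)"
    by (simp add: antimono_gelfand_number[OF T'] gelfand_number_nonneg[OF T']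
        gelfand_number_levels[OF assms] del: of_real_power)
  fix s assume "?P s"
  then show "s = gelfand_number T"
    using g by (intro antimono_eq_if_level_cards_eq) auto
qed

section \<open>The Schatten quasi-norm\<close>

text \<open>
  On the Schatten class this is the \<open>p\<close>-th power of the quasi-norm.  It is small exactly when the
  quasi-norm is, and estimates for it are estimates of sums, without roots.
\<close>

definition schatten_sum :: "real \<Rightarrow> ('a::chilbert_space \<Rightarrow> 'a) \<Rightarrow> real"
  where "schatten_sum p T = (\<Sum>n. gelfand_number T n powr p)"

lemma schatten_class_iff:
  "T \<in> schatten_class p \<longleftrightarrow> compact_op T \<and> summable (\<lambda>n. gelfand_number T n powr p)"
  by (auto simp: schatten_class_def singular_value_eq_gelfand_number)

lemma schatten_norm_eq:
  "compact_op T \<Longrightarrow> schatten_norm p T = schatten_sum p T powr (1 / p)"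
  by (simp add: schatten_norm_def schatten_sum_def singular_value_eq_gelfand_number)

lemma schatten_class_bounded_clinear: "T \<in> schatten_class p \<Longrightarrow> bounded_clinear T"
  by (simp add: schatten_class_iff compact_op_bounded_clinear)

lemma schatten_sum_nonneg: "T \<in> schatten_class p \<Longrightarrow> 0 \<le> schatten_sum p T"
  unfolding schatten_sum_def by (rule suminf_nonneg) (simp_all add: schatten_class_iff)

lemma schatten_classI:
  assumes "compact_op T" "\<And>N. (\<Sum>n<N. gelfand_number T n powr p) \<le> b"
  shows "T \<in> schatten_class p" "schatten_sum p T \<le> b"
proof -
  have s: "summable (\<lambda>n. gelfand_number T n powr p)"
    by (rule summableI_nonneg_bounded[OF _ assms(2)]) simp
  then show "T \<in> schatten_class p" using assms(1) by (simp add: schatten_class_iff)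
  show "schatten_sum p T \<le> b"
    unfolding schatten_sum_def by (rule suminf_le_const[OF s assms(2)])
qed

lemma sum_gelfand_number_le:
  assumes "T \<in> schatten_class p"
  shows "(\<Sum>n<N. gelfand_number T n powr p) \<le> schatten_sum p T"
  unfolding schatten_sum_def using assms by (intro sum_le_suminf) (simp_all add: schatten_class_iff)

lemma bounded_off_add:
  assumes "bounded_off S m c" "bounded_off T n d"
  shows "bounded_off (\<lambda>x. S x + T x) (m + n) (c + d)"
proof -
  obtain E where E: "finite E" "card E \<le> m" "\<And>x. \<forall>e\<in>E. cinner e x = 0 \<Longrightarrow> norm (S x) \<le> c * norm x"
    using assms(1) unfolding bounded_off_def by (elim exE conjE) simp
  obtain F where F: "finite F" "card F \<le> n" "\<And>x. \<forall>e\<in>F. cinner e x = 0 \<Longrightarrow> norm (T x) \<le> d * norm x"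
    using assms(2) unfolding bounded_off_def by (elim exE conjE) simp
  have "card (E \<union> F) \<le> m + n" using card_Un_le[of E F] E(2) F(2) by linarith
  moreover have "norm (S x + T x) \<le> (c + d) * norm x" if "\<forall>e\<in>E \<union> F. cinner e x = 0" for x
    using norm_triangle_ineq[of "S x" "T x"] E(3)[of x] F(3)[of x] that by (simp add: distrib_right)
  ultimately show ?thesis
    unfolding bounded_off_def using E(1) F(1) by (intro exI[of _ "E \<union> F"]) simp
qed

lemma gelfand_number_add:
  assumes "bounded_clinear S" "bounded_clinear T"
  shows "gelfand_number (\<lambda>x. S x + T x) (m + n) \<le> gelfand_number S m + gelfand_number T n"
proof (rule field_le_epsilon)
  fix \<epsilon> :: real assume \<epsilon>: "0 < \<epsilon>"
  have "bounded_off (\<lambda>x. S x + T x) (m + n)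
      ((gelfand_number S m + \<epsilon>/2) + (gelfand_number T n + \<epsilon>/2))"
    using \<epsilon> by (intro bounded_off_add bounded_off_gelfand_number assms) simp_all
  then have "gelfand_number (\<lambda>x. S x + T x) (m + n)
      \<le> (gelfand_number S m + \<epsilon>/2) + (gelfand_number T n + \<epsilon>/2)"
    using \<epsilon> gelfand_number_nonneg[OF assms(1)] gelfand_number_nonneg[OF assms(2)]
    by (intro gelfand_number_le) (simp_all add: add_nonneg_nonneg)
  then show "gelfand_number (\<lambda>x. S x + T x) (m + n) \<le> gelfand_number S m + gelfand_number T n + \<epsilon>"
    by simp
qed

text \<open>
  Gelfand numbers are Lipschitz in the operator norm, because the 0-th one is the operator norm.
\<close>

lemma gelfand_number_perturb:
  assumes S: "bounded_clinear S" and T: "bounded_clinear T"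
    and diff: "\<And>x. norm (S x - T x) \<le> \<epsilon> * norm x" and \<epsilon>: "0 \<le> \<epsilon>"
  shows "gelfand_number S n \<le> gelfand_number T n + \<epsilon>"
proof -
  have "gelfand_number (\<lambda>x. T x + (S x - T x)) (n + 0)
      \<le> gelfand_number T n + gelfand_number (\<lambda>x. S x - T x) 0"
    by (rule gelfand_number_add[OF T bounded_clinear_diff[OF S T]])
  moreover have "gelfand_number (\<lambda>x. S x - T x) 0 \<le> \<epsilon>"
    by (rule gelfand_number_le) (simp_all add: bounded_off_0_iff diff \<epsilon>)
  ultimately show ?thesis by simp
qed

lemma gelfand_number_scaled:
  assumes T: "bounded_clinear T" and M: "0 \<le> M"
    and imp: "\<And>c. 0 \<le> c \<Longrightarrow> bounded_off T n c \<Longrightarrow> bounded_off S n (M * c)"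
  shows "gelfand_number S n \<le> M * gelfand_number T n"
proof (rule field_le_epsilon)
  fix \<epsilon> :: real assume \<epsilon>: "0 < \<epsilon>"
  define d where "d = gelfand_number T n + \<epsilon> / (M + 1)"
  have pos: "0 < \<epsilon> / (M + 1)" using \<epsilon> M by simp
  then have d0: "0 \<le> d" using gelfand_number_nonneg[OF T, of n] by (simp add: d_def)
  have "bounded_off T n d"
    using pos by (intro bounded_off_gelfand_number[OF T]) (simp add: d_def)
  then have "gelfand_number S n \<le> M * d"
    using imp[OF d0] d0 M by (intro gelfand_number_le) simp_all
  also have "\<dots> \<le> M * gelfand_number T n + \<epsilon>"
    using M \<epsilon> by (simp add: d_def distrib_left field_simps)
  finally show "gelfand_number S n \<le> M * gelfand_number T n + \<epsilon>" .
qed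

lemma gelfand_number_compose_left:
  assumes T: "bounded_clinear T" and A: "\<And>x. norm (A x) \<le> M * norm x" and M: "0 \<le> M"
  shows "gelfand_number (\<lambda>x. A (T x)) n \<le> M * gelfand_number T n"
proof (rule gelfand_number_scaled[OF T M])
  fix c assume "bounded_off T n c"
  then obtain E where E: "finite E" "card E \<le> n" "\<And>x. \<forall>e\<in>E. cinner e x = 0 \<Longrightarrow> norm (T x) \<le> c * norm x"
    unfolding bounded_off_def by (elim exE conjE) simp
  have "norm (A (T x)) \<le> M * c * norm x" if "\<forall>e\<in>E. cinner e x = 0" for x
    using A[of "T x"] mult_left_mono[OF E(3)[OF that] M] by simp
  then show "bounded_off (\<lambda>x. A (T x)) n (M * c)"
    unfolding bounded_off_def using E(1,2) by (intro exI[of _ E]) simp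
qed

text \<open>
  If \<open>T\<close> is small off \<open>E\<close>, then \<open>T B\<close> is small off \<open>B\<^sup>* E\<close>.
\<close>

lemma gelfand_number_compose_right:
  assumes T: "bounded_clinear T" and B: "bounded_clinear B"
    and BM: "\<And>x. norm (B x) \<le> M * norm x" and M: "0 \<le> M"
  shows "gelfand_number (\<lambda>x. T (B x)) n \<le> M * gelfand_number T n"
proof (rule gelfand_number_scaled[OF T M])
  fix c :: real assume c: "0 \<le> c" and "bounded_off T n c"
  then obtain E where E: "finite E" "card E \<le> n" "\<And>x. \<forall>e\<in>E. cinner e x = 0 \<Longrightarrow> norm (T x) \<le> c * norm x"
    unfolding bounded_off_def by (elim exE conjE) simp
  have "norm (T (B x)) \<le> M * c * norm x" if "\<forall>e\<in>adjoint_op B ` E. cinner e x = 0" for x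
  proof -
    have "\<forall>e\<in>E. cinner e (B x) = 0" using that by (simp add: cinner_adjoint_op[OF B])
    from E(3)[OF this] have "norm (T (B x)) \<le> c * norm (B x)" .
    also have "\<dots> \<le> c * (M * norm x)" by (rule mult_left_mono[OF BM c])
    finally show ?thesis by (simp add: mult_ac)
  qed
  moreover have "card (adjoint_op B ` E) \<le> n" using card_image_le[OF E(1)] E(2) order_trans by metis
  ultimately show "bounded_off (\<lambda>x. T (B x)) n (M * c)"
    unfolding bounded_off_def using E(1) by (intro exI[of _ "adjoint_op B ` E"]) simp
qed

lemma schatten_class_zero:
  shows "(\<lambda>x::'a::chilbert_space. 0::'a) \<in> schatten_class p"
    and "schatten_sum p (\<lambda>x::'a. 0::'a) = 0"
proof -
  have "gelfand_number (\<lambda>x::'a. 0::'a) n = 0" for n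
  proof (rule order_antisym)
    show "gelfand_number (\<lambda>x::'a. 0::'a) n \<le> 0"
      by (intro gelfand_number_le bounded_off_all) simp_all
  qed (rule gelfand_number_nonneg[OF bounded_clinear_zero])
  then show "(\<lambda>x::'a. 0::'a) \<in> schatten_class p" "schatten_sum p (\<lambda>x::'a. 0::'a) = 0"
    by (simp_all add: schatten_class_iff schatten_sum_def compact_op_zero)
qed

lemma schatten_class_scaled:
  assumes T: "T \<in> schatten_class p" and S: "compact_op S" and p: "0 < p" and M: "0 \<le> M"
    and le: "\<And>n. gelfand_number S n \<le> M * gelfand_number T n"
  shows "S \<in> schatten_class p" "schatten_sum p S \<le> M powr p * schatten_sum p T"
proof -
  note nn = gelfand_number_nonneg[OF compact_op_bounded_clinear[OF S]]
  have "(\<Sum>n<N. gelfand_number S n powr p) \<le> M powr p * schatten_sum p T" for N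
  proof -
    have "(\<Sum>n<N. gelfand_number S n powr p) \<le> (\<Sum>n<N. M powr p * gelfand_number T n powr p)"
      using powr_mono2[OF less_imp_le[OF p] nn le] M
        gelfand_number_nonneg[OF schatten_class_bounded_clinear[OF T]]
      by (intro sum_mono) (simp add: powr_mult)
    also have "\<dots> = M powr p * (\<Sum>n<N. gelfand_number T n powr p)"
      by (simp add: sum_distrib_left)
    also have "\<dots> \<le> M powr p * schatten_sum p T"
      by (rule mult_left_mono[OF sum_gelfand_number_le[OF T]]) simp
    finally show ?thesis .
  qed
  from schatten_classI[OF S this] show "S \<in> schatten_class p"
    "schatten_sum p S \<le> M powr p * schatten_sum p T" .
qed

lemma schatten_class_compose_left:
  assumes T: "T \<in> schatten_class p" and A: "bounded_clinear A" and p: "0 < p" and M: "0 \<le> M"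
    and AM: "\<And>x. norm (A x) \<le> M * norm x"
  shows "(\<lambda>x. A (T x)) \<in> schatten_class p" "schatten_sum p (\<lambda>x. A (T x)) \<le> M powr p * schatten_sum p T"
proof -
  have c: "compact_op (\<lambda>x. A (T x))"
    using T by (intro compact_op_compose_left[OF A]) (simp add: schatten_class_iff)
  note * = schatten_class_scaled[OF T c p M
      gelfand_number_compose_left[OF schatten_class_bounded_clinear[OF T] AM M]]
  show "(\<lambda>x. A (T x)) \<in> schatten_class p" by (rule *(1))
  show "schatten_sum p (\<lambda>x. A (T x)) \<le> M powr p * schatten_sum p T" by (rule *(2))
qed

lemma schatten_class_compose_right:
  assumes T: "T \<in> schatten_class p" and B: "bounded_clinear B" and p: "0 < p" and M: "0 \<le> M"
    and BM: "\<And>x. norm (B x) \<le> M * norm x"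
  shows "(\<lambda>x. T (B x)) \<in> schatten_class p" "schatten_sum p (\<lambda>x. T (B x)) \<le> M powr p * schatten_sum p T"
proof -
  have c: "compact_op (\<lambda>x. T (B x))"
    using T by (intro compact_op_compose_right[OF B]) (simp add: schatten_class_iff)
  note * = schatten_class_scaled[OF T c p M
      gelfand_number_compose_right[OF schatten_class_bounded_clinear[OF T] B BM M]]
  show "(\<lambda>x. T (B x)) \<in> schatten_class p" by (rule *(1))
  show "schatten_sum p (\<lambda>x. T (B x)) \<le> M powr p * schatten_sum p T" by (rule *(2))
qed

lemma schatten_class_scaleC:
  assumes "T \<in> schatten_class p" "0 < p"
  shows "(\<lambda>x. c *\<^sub>C T x) \<in> schatten_class p"
    "schatten_sum p (\<lambda>x. c *\<^sub>C T x) \<le> cmod c powr p * schatten_sum p T"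
proof -
  note * = schatten_class_compose_left[OF assms(1) bounded_clinear_scaleC assms(2) norm_ge_zero]
  show "(\<lambda>x. c *\<^sub>C T x) \<in> schatten_class p" by (rule *(1)[of c c]) (simp add: norm_scaleC)
  show "schatten_sum p (\<lambda>x. c *\<^sub>C T x) \<le> cmod c powr p * schatten_sum p T"
    by (rule *(2)[of c c]) (simp add: norm_scaleC)
qed

text \<open>
  One factor 2 arises because a Gelfand number of a sum with index \<open>2 n\<close> or \<open>2 n + 1\<close> is controlled by
  those of the summands with index \<open>n\<close>, the factor \<open>2 powr p\<close> from the \<open>p\<close>-th power of a sum of two
  numbers.  That the constant exceeds 1 does no harm to infinite series whose terms decrease
  geometrically with an adjustable ratio.
\<close>

definition quasi_constant :: "real \<Rightarrow> real"
  where "quasi_constant p = 2 * 2 powr p"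

lemma powr_add_le:
  fixes a b p :: real
  assumes "0 \<le> a" "0 \<le> b" "0 < p"
  shows "(a + b) powr p \<le> 2 powr p * (a powr p + b powr p)"
proof -
  have "(a + b) powr p \<le> (2 * max a b) powr p" using assms by (intro powr_mono2) auto
  also have "\<dots> = 2 powr p * max a b powr p" using assms by (simp add: powr_mult)
  also have "\<dots> \<le> 2 powr p * (a powr p + b powr p)"
    by (intro mult_left_mono) (auto simp: max_def)
  finally show ?thesis .
qed

lemma schatten_class_add:
  assumes S: "S \<in> schatten_class p" and T: "T \<in> schatten_class p" and p: "0 < p"
  shows "(\<lambda>x. S x + T x) \<in> schatten_class p"
    "schatten_sum p (\<lambda>x. S x + T x) \<le> quasi_constant p * (schatten_sum p S + schatten_sum p T)"
proof -
  note S' = schatten_class_bounded_clinear[OF S] and T' = schatten_class_bounded_clinear[OF T]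
  let ?g = "gelfand_number (\<lambda>x. S x + T x)"
  let ?h = "\<lambda>n. 2 powr p * (gelfand_number S n powr p + gelfand_number T n powr p)"
  have c: "compact_op (\<lambda>x. S x + T x)" using S T by (simp add: schatten_class_iff compact_op_add)
  note g0 = gelfand_number_nonneg[OF compact_op_bounded_clinear[OF c]]
  have even: "?g (2 * n) powr p \<le> ?h n" for n
  proof -
    have "?g (2 * n) \<le> gelfand_number S n + gelfand_number T n"
      using gelfand_number_add[OF S' T', of n n] by (simp add: mult_2)
    then have "?g (2 * n) powr p \<le> (gelfand_number S n + gelfand_number T n) powr p"
      using p g0 by (intro powr_mono2) auto
    also have "\<dots> \<le> ?h n" by (intro powr_add_le gelfand_number_nonneg S' T' p)
    finally show ?thesis .
  qed
  have odd: "?g (Suc (2 * n)) powr p \<le> ?h n" for n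
  proof -
    have "?g (Suc (2 * n)) \<le> ?g (2 * n)"
      by (rule antimonoD[OF antimono_gelfand_number[OF compact_op_bounded_clinear[OF c]]]) simp
    then have "?g (Suc (2 * n)) powr p \<le> ?g (2 * n) powr p" using p g0 by (intro powr_mono2) auto
    then show ?thesis using even[of n] by linarith
  qed
  have double: "(\<Sum>n<2 * N. ?g n powr p) \<le> 2 * (\<Sum>n<N. ?h n)" for N
  proof (induction N)
    case (Suc N)
    then show ?case using even[of N] odd[of N] by simp
  qed simp
  have "(\<Sum>n<N. ?g n powr p) \<le> quasi_constant p * (schatten_sum p S + schatten_sum p T)" for N
  proof -
    have "(\<Sum>n<N. ?g n powr p) \<le> (\<Sum>n<2 * N. ?g n powr p)" by (intro sum_mono2) auto
    also have "\<dots> \<le> 2 * (\<Sum>n<N. ?h n)" by (rule double)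
    also have "\<dots> = quasi_constant p *
        ((\<Sum>n<N. gelfand_number S n powr p) + (\<Sum>n<N. gelfand_number T n powr p))"
      by (simp add: quasi_constant_def sum.distrib flip: sum_distrib_left)
    also have "\<dots> \<le> quasi_constant p * (schatten_sum p S + schatten_sum p T)"
      by (intro mult_left_mono add_mono sum_gelfand_number_le S T) (simp add: quasi_constant_def)
    finally show ?thesis .
  qed
  from schatten_classI[OF c this] show "(\<lambda>x. S x + T x) \<in> schatten_class p"
    "schatten_sum p (\<lambda>x. S x + T x) \<le> quasi_constant p * (schatten_sum p S + schatten_sum p T)" .
qed

lemma norm_le_schatten_sum:
  assumes T: "T \<in> schatten_class p" and p: "0 < p"
  shows "norm (T x) \<le> schatten_sum p T powr (1/p) * norm x"
proof -
  note T' = schatten_class_bounded_clinear[OF T]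
  have "norm (T x) \<le> gelfand_number T 0 * norm x"
  proof (rule field_le_epsilon)
    fix \<epsilon> :: real assume \<epsilon>: "0 < \<epsilon>"
    have pos: "0 < \<epsilon> / (norm x + 1)" using \<epsilon> by (simp add: add_nonneg_pos)
    then have "bounded_off T 0 (gelfand_number T 0 + \<epsilon> / (norm x + 1))"
      by (intro bounded_off_gelfand_number[OF T']) simp
    then have "norm (T x) \<le> (gelfand_number T 0 + \<epsilon> / (norm x + 1)) * norm x"
      by (simp add: bounded_off_0_iff)
    also have "\<dots> = gelfand_number T 0 * norm x + \<epsilon> * (norm x / (norm x + 1))"
      by (simp add: distrib_right)
    also have "\<dots> \<le> gelfand_number T 0 * norm x + \<epsilon>"
      using \<epsilon> by (intro add_left_mono mult_left_le) (simp_all add: divide_le_eq_1 add_nonneg_pos)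
    finally show "norm (T x) \<le> gelfand_number T 0 * norm x + \<epsilon>" .
  qed
  also have "\<dots> \<le> schatten_sum p T powr (1/p) * norm x"
  proof (rule mult_right_mono)
    have "gelfand_number T 0 = (gelfand_number T 0 powr p) powr (1/p)"
      using p gelfand_number_nonneg[OF T', of 0] by (simp add: powr_powr)
    also have "\<dots> \<le> schatten_sum p T powr (1/p)"
      using sum_gelfand_number_le[OF T, of 1] p by (intro powr_mono2) simp_all
    finally show "gelfand_number T 0 \<le> schatten_sum p T powr (1/p)" .
  qed simp
  finally show ?thesis .
qed

text \<open>
  Lower semicontinuity: under convergence in operator norm every Gelfand number converges, so each
  partial sum of \<open>p\<close>-th powers stays below \<open>b\<close>.
\<close>

lemma schatten_class_limit:
  assumes p: "0 < p" and L: "bounded_clinear L" and T: "\<And>k. T k \<in> schatten_class p"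
    and b: "\<And>k. schatten_sum p (T k) \<le> b"
    and \<epsilon>: "\<epsilon> \<longlonglongrightarrow> 0" "\<And>k. 0 \<le> \<epsilon> k" "\<And>k x. norm (L x - T k x) \<le> \<epsilon> k * norm x"
  shows "L \<in> schatten_class p" "schatten_sum p L \<le> b"
proof -
  note T' = schatten_class_bounded_clinear[OF T]
  have c: "compact_op L"
  proof (rule compact_op_limit[OF L])
    fix e :: real assume "0 < e"
    then obtain k where k: "\<epsilon> k < e"
      using order_tendstoD(2)[OF \<epsilon>(1)] by (auto simp: eventually_sequentially)
    have "norm (L x - T k x) \<le> e * norm x" for x
      using \<epsilon>(3)[of x k] k mult_right_mono[of "\<epsilon> k" e "norm x"] by simp
    then show "\<exists>T. compact_op T \<and> (\<forall>x. norm (L x - T x) \<le> e * norm x)"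
      using T[of k] by (auto simp: schatten_class_iff)
  qed
  have lim: "(\<lambda>k. gelfand_number (T k) n) \<longlonglongrightarrow> gelfand_number L n" for n
  proof (rule LIM_zero_cancel, rule Lim_null_comparison[OF always_eventually \<epsilon>(1)], rule allI)
    fix k
    have "gelfand_number L n \<le> gelfand_number (T k) n + \<epsilon> k"
      by (rule gelfand_number_perturb[OF L T' \<epsilon>(3,2)])
    moreover have "gelfand_number (T k) n \<le> gelfand_number L n + \<epsilon> k"
      using \<epsilon>(3) by (intro gelfand_number_perturb[OF T' L _ \<epsilon>(2)]) (simp add: norm_minus_commute)
    ultimately show "norm (gelfand_number (T k) n - gelfand_number L n) \<le> \<epsilon> k" by simp
  qed
  have "(\<Sum>n<N. gelfand_number L n powr p) \<le> b" for N
  proof (rule LIMSEQ_le_const2)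
    show "(\<lambda>k. \<Sum>n<N. gelfand_number (T k) n powr p) \<longlonglongrightarrow> (\<Sum>n<N. gelfand_number L n powr p)"
      using gelfand_number_nonneg[OF T'] p
      by (intro tendsto_sum tendsto_powr' lim tendsto_const) (auto intro: always_eventually)
    show "\<exists>K. \<forall>k\<ge>K. (\<Sum>n<N. gelfand_number (T k) n powr p) \<le> b"
      using sum_gelfand_number_le[OF T] b order_trans by blast
  qed
  from schatten_classI[OF c this] show "L \<in> schatten_class p" "schatten_sum p L \<le> b" .
qed

lemma schatten_class_finite_sum:
  assumes p: "0 < p" and C: "\<And>k. C k \<in> schatten_class p"
  shows "(\<lambda>x. \<Sum>k<n. C k x) \<in> schatten_class p \<and>
    schatten_sum p (\<lambda>x. \<Sum>k<n. C k x) \<le> (\<Sum>k<n. quasi_constant p ^ Suc k * schatten_sum p (C k))"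
  using C
proof (induction n arbitrary: C)
  case 0
  then show ?case by (simp add: schatten_class_zero)
next
  case (Suc n)
  let ?D = "\<lambda>x. \<Sum>k<n. C (Suc k) x"
  have D: "?D \<in> schatten_class p"
    "schatten_sum p ?D \<le> (\<Sum>k<n. quasi_constant p ^ Suc k * schatten_sum p (C (Suc k)))"
    using Suc.IH[of "\<lambda>k. C (Suc k)"] Suc.prems by auto
  have split: "(\<lambda>x. \<Sum>k<Suc n. C k x) = (\<lambda>x. C 0 x + ?D x)" by (simp add: sum.lessThan_Suc_shift del: sum.lessThan_Suc)
  have "schatten_sum p (\<lambda>x. C 0 x + ?D x) \<le> quasi_constant p * (schatten_sum p (C 0) + schatten_sum p ?D)"
    by (rule schatten_class_add(2)[OF Suc.prems D(1) p])
  also have "\<dots> \<le> quasi_constant p * (schatten_sum p (C 0) +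
      (\<Sum>k<n. quasi_constant p ^ Suc k * schatten_sum p (C (Suc k))))"
    using D(2) by (intro mult_left_mono) (simp_all add: quasi_constant_def)
  also have "\<dots> = (\<Sum>k<Suc n. quasi_constant p ^ Suc k * schatten_sum p (C k))"
    by (simp add: sum.lessThan_Suc_shift distrib_left sum_distrib_left mult.assoc del: sum.lessThan_Suc)
  finally show ?case unfolding split using schatten_class_add(1)[OF Suc.prems D(1) p] by simp
qed

lemma quasi_constant_ge_1:
  assumes "0 < p"
  shows "1 \<le> quasi_constant p"
proof -
  have "1 \<le> 2 powr p" using assms by (intro ge_one_powr_ge_zero) simp_all
  then show ?thesis unfolding quasi_constant_def by linarith
qed

text \<open>
  Peeling off one summand at a time costs one factor \<open>quasi_constant p\<close> each, whence the weights.  The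
  same estimate for the tails controls them in operator norm, so the limit lemma applies to the
  partial sums.
\<close>

lemma schatten_class_series:
  assumes p: "0 < p" and C: "\<And>k. C k \<in> schatten_class p"
    and summ: "summable (\<lambda>k. quasi_constant p ^ Suc k * schatten_sum p (C k))"
    and L: "\<And>x. (\<lambda>k. C k x) sums L x"
  shows "L \<in> schatten_class p"
    "schatten_sum p L \<le> (\<Sum>k. quasi_constant p ^ Suc k * schatten_sum p (C k))"
proof -
  let ?Q = "quasi_constant p"
  let ?a = "\<lambda>k. ?Q ^ Suc k * schatten_sum p (C k)"
  have a0: "0 \<le> ?a k" for k
    using quasi_constant_ge_1[OF p] by (intro mult_nonneg_nonneg schatten_sum_nonneg C) simp
  note summ_shift = summable_ignore_initial_segment[OF summ]
  define t where "t n = (\<Sum>k. ?a (k + n))" for n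
  have t0: "0 \<le> t n" for n
    unfolding t_def by (rule suminf_nonneg[OF summ_shift a0])
  have t_lim: "t \<longlonglongrightarrow> 0"
  proof -
    have "(\<lambda>n. suminf ?a - (\<Sum>k<n. ?a k)) \<longlonglongrightarrow> suminf ?a - suminf ?a"
      by (intro tendsto_intros summable_LIMSEQ summ)
    moreover have "t = (\<lambda>n. suminf ?a - (\<Sum>k<n. ?a k))"
      unfolding t_def using suminf_minus_initial_segment[OF summ] by auto
    ultimately show ?thesis by simp
  qed
  let ?P = "\<lambda>n x. \<Sum>k<n. C k x"
  have tail: "norm (L x - ?P n x) \<le> t n powr (1/p) * norm x" for n x
  proof (rule LIMSEQ_le_const2)
    have "(\<lambda>k. C (k + n) x) sums (L x - ?P n x)" by (rule sums_split_initial_segment[OF L])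
    then show "(\<lambda>m. norm (\<Sum>k<m. C (k + n) x)) \<longlonglongrightarrow> norm (L x - ?P n x)"
      unfolding sums_def by (rule tendsto_norm)
    have "norm (\<Sum>k<m. C (k + n) x) \<le> t n powr (1/p) * norm x" for m
    proof -
      note D = schatten_class_finite_sum[OF p, of "\<lambda>k. C (k + n)" m, OF C]
      have "schatten_sum p (\<lambda>x. \<Sum>k<m. C (k + n) x) \<le> (\<Sum>k<m. ?Q ^ Suc k * schatten_sum p (C (k + n)))"
        using D by simp
      also have "\<dots> \<le> (\<Sum>k<m. ?a (k + n))"
        using quasi_constant_ge_1[OF p]
        by (intro sum_mono mult_right_mono schatten_sum_nonneg C power_increasing) auto
      also have "\<dots> \<le> t n"
        unfolding t_def by (rule sum_le_suminf[OF summ_shift finite_lessThan a0])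
      finally have "schatten_sum p (\<lambda>x. \<Sum>k<m. C (k + n) x) powr (1/p) \<le> t n powr (1/p)"
        using p D by (intro powr_mono2 schatten_sum_nonneg) simp_all
      then show ?thesis
        by (intro order_trans[OF norm_le_schatten_sum[OF conjunct1[OF D] p]] mult_right_mono) simp_all
    qed
    then show "\<exists>N. \<forall>m\<ge>N. norm (\<Sum>k<m. C (k + n) x) \<le> t n powr (1/p) * norm x" by blast
  qed
  have L': "bounded_clinear L"
  proof (rule bounded_clinearI)
    note C' = schatten_class_bounded_clinear[OF C]
    show "L (x + y) = L x + L y" for x y
      using sums_add[OF L[of x] L[of y]] L[of "x + y"]
      by (simp add: bounded_clinearD(3)[OF C'] sums_unique2)
    show "L (c *\<^sub>C x) = c *\<^sub>C L x" for c x
      using bounded_linear.sums[OF bounded_clinearD(1)[OF bounded_clinear_scaleC] L[of x], of c]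
        L[of "c *\<^sub>C x"]
      by (simp add: bounded_clinearD(2)[OF C'] sums_unique2)
    show "norm (L x) \<le> norm x * t 0 powr (1/p)" for x using tail[of x 0] by (simp add: mult.commute)
  qed
  have lim: "(\<lambda>n. t n powr (1/p)) \<longlonglongrightarrow> 0"
    using tendsto_powr'[OF t_lim tendsto_const, of "1/p"] t0 p by (simp add: always_eventually)
  have fin: "?P n \<in> schatten_class p" "schatten_sum p (?P n) \<le> suminf ?a" for n
  proof -
    note D = schatten_class_finite_sum[OF p, of C n, OF C]
    show "?P n \<in> schatten_class p" using D by simp
    have "(\<Sum>k<n. ?a k) \<le> suminf ?a" using a0 by (intro sum_le_suminf summ) auto
    then show "schatten_sum p (?P n) \<le> suminf ?a" using D by linarith
  qed
  show "L \<in> schatten_class p" "schatten_sum p L \<le> suminf ?a"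
    by (rule schatten_class_limit[OF p L' fin lim _ tail], simp)+
qed

section \<open>Riemann sums along a curve\<close>

text \<open>
  The values are allowed in any Hilbert space: in the complex numbers for the scalar coefficients, and
  in the given space for an operator-valued function evaluated at a vector.
\<close>

definition stieltjes_sum ::
  "(real \<Rightarrow> complex) \<Rightarrow> (real \<Rightarrow> 'a::chilbert_space) \<Rightarrow> nat \<Rightarrow> (nat \<Rightarrow> real) \<Rightarrow> (nat \<Rightarrow> real) \<Rightarrow> 'a"
  where "stieltjes_sum \<gamma> g n t \<tau> = (\<Sum>j<n. (\<gamma> (t (Suc j)) - \<gamma> (t j)) *\<^sub>C g (\<tau> j))"

lemma tagged_partition_mono:
  "tagged_partition \<delta> n t \<tau> \<Longrightarrow> \<delta> \<le> \<delta>' \<Longrightarrow> tagged_partition \<delta>' n t \<tau>"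
  unfolding tagged_partition_def by force

lemma tagged_partition_points:
  assumes P: "tagged_partition \<delta> n t \<tau>" and j: "j \<le> n"
  shows "0 \<le> t j" "t j \<le> 1"
proof -
  have le_Suc: "t i \<le> t (Suc i)" if "i < n" for i
    using P that unfolding tagged_partition_def by (simp add: less_imp_le)
  have "t 0 \<le> t j" using j
  proof (induction j)
    case (Suc j)
    then show ?case using le_Suc[of j] by simp
  qed simp
  moreover have "t j \<le> t n"
    using j
  proof (induction rule: inc_induct)
    case (step i)
    then show ?case using le_Suc[of i] by linarith
  qed simp
  ultimately show "0 \<le> t j" "t j \<le> 1" using P by (simp_all add: tagged_partition_def)
qed

lemma tagged_partition_tags:
  assumes P: "tagged_partition \<delta> n t \<tau>" and j: "j < n"
  shows "t j \<le> \<tau> j" "\<tau> j \<le> t (Suc j)" "\<tau> j \<in> {0..1}" "t (Suc j) - t j < \<delta>" "t j \<le> t (Suc j)"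
proof -
  have *: "t j \<le> \<tau> j" "\<tau> j \<le> t (Suc j)" "t (Suc j) - t j < \<delta>"
    using P j unfolding tagged_partition_def by simp_all
  then show "t j \<le> \<tau> j" "\<tau> j \<le> t (Suc j)" "t (Suc j) - t j < \<delta>" "t j \<le> t (Suc j)" by simp_all
  show "\<tau> j \<in> {0..1}"
    using * tagged_partition_points(1)[OF P, of j] tagged_partition_points(2)[OF P, of "Suc j"] j by simp
qed

lemma stieltjes_sum_bound:
  assumes P: "tagged_partition \<delta> n t \<tau>"
    and lip: "\<And>a b. 0 \<le> a \<Longrightarrow> a \<le> b \<Longrightarrow> b \<le> 1 \<Longrightarrow> cmod (\<gamma> b - \<gamma> a) \<le> V * (b - a)" and V: "0 \<le> V"
    and B: "\<And>s. s \<in> {0..1} \<Longrightarrow> norm (g s) \<le> B"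
  shows "norm (stieltjes_sum \<gamma> g n t \<tau>) \<le> V * B"
proof -
  have "norm (stieltjes_sum \<gamma> g n t \<tau>) \<le> (\<Sum>j<n. V * B * (t (Suc j) - t j))"
    unfolding stieltjes_sum_def
  proof (rule sum_norm_le)
    fix j assume "j \<in> {..<n}"
    then have j: "j < n" by simp
    note T = tagged_partition_tags[OF P j]
    have "cmod (\<gamma> (t (Suc j)) - \<gamma> (t j)) * norm (g (\<tau> j)) \<le> (V * (t (Suc j) - t j)) * B"
      using j T V tagged_partition_points[OF P, of j] tagged_partition_points[OF P, of "Suc j"]
      by (intro mult_mono lip B mult_nonneg_nonneg) simp_all
    then show "norm ((\<gamma> (t (Suc j)) - \<gamma> (t j)) *\<^sub>C g (\<tau> j)) \<le> V * B * (t (Suc j) - t j)"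
      by (simp add: norm_scaleC mult_ac)
  qed
  also have "\<dots> = V * B * (\<Sum>j<n. t (Suc j) - t j)" by (simp add: sum_distrib_left)
  also have "\<dots> = V * B"
    using P by (simp add: sum_lessThan_telescope tagged_partition_def)
  finally show ?thesis .
qed

lemma C1_curve_lipschitz:
  fixes \<gamma> \<gamma>' :: "real \<Rightarrow> complex"
  assumes "\<And>t. t \<in> {0..1} \<Longrightarrow> (\<gamma> has_vector_derivative \<gamma>' t) (at t within {0..1})"
    and "\<And>t. t \<in> {0..1} \<Longrightarrow> cmod (\<gamma>' t) \<le> V"
    and ab: "0 \<le> a" "a \<le> b" "b \<le> 1"
  shows "cmod (\<gamma> b - \<gamma> a) \<le> V * (b - a)"
proof -
  have "(\<gamma>' has_integral (\<gamma> b - \<gamma> a)) {a..b}"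
    using ab by (intro fundamental_theorem_of_calculus)
      (auto intro: has_vector_derivative_within_subset[OF assms(1)])
  then have "norm (\<gamma> b - \<gamma> a) \<le> V * measure lborel {a..b}"
    using order_trans[OF norm_ge_zero assms(2)[of 0]] ab
    by (intro has_integral_bound_real[where S = "{}" and f = \<gamma>']) (auto intro!: assms(2))
  then show ?thesis using ab by simp
qed

text \<open>
  On each subinterval the increment of \<open>\<gamma>\<close> is the integral of \<open>\<gamma>'\<close>, so the error is the integral of
  \<open>(\<phi> (\<tau> j) - \<phi> s) \<gamma>' s\<close>.
\<close>

lemma stieltjes_sum_integral:
  fixes \<gamma> \<gamma>' \<phi> :: "real \<Rightarrow> complex"
  assumes \<gamma>: "\<And>t. t \<in> {0..1} \<Longrightarrow> (\<gamma> has_vector_derivative \<gamma>' t) (at t within {0..1})"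
    and cont': "continuous_on {0..1} \<gamma>'" and V: "\<And>t. t \<in> {0..1} \<Longrightarrow> cmod (\<gamma>' t) \<le> V"
    and cont: "continuous_on {0..1} \<phi>"
    and e: "0 \<le> e" "\<And>u v. u \<in> {0..1} \<Longrightarrow> v \<in> {0..1} \<Longrightarrow> \<bar>u - v\<bar> < \<delta> \<Longrightarrow> cmod (\<phi> u - \<phi> v) \<le> e"
    and P: "tagged_partition \<delta> n t \<tau>"
  shows "cmod (stieltjes_sum \<gamma> \<phi> n t \<tau> - integral {0..1} (\<lambda>s. \<phi> s * \<gamma>' s)) \<le> e * V"
proof -
  have V0: "0 \<le> V" using order_trans[OF norm_ge_zero V[of 0]] by simp
  have "cmod (stieltjes_sum \<gamma> \<phi> m t \<tau> - integral {0..t m} (\<lambda>s. \<phi> s * \<gamma>' s)) \<le> e * V * t m" if "m \<le> n" for m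
    using that
  proof (induction m)
    case 0
    then show ?case using P by (simp add: stieltjes_sum_def tagged_partition_def)
  next
    case (Suc m)
    then have m: "m < n" by simp
    note T = tagged_partition_tags[OF P m]
    note b = tagged_partition_points[OF P, of m] tagged_partition_points[OF P, of "Suc m"]
    let ?a = "t m" and ?b = "t (Suc m)"
    have sub: "{?a..?b} \<subseteq> {0..1}" using b m by auto
    have c': "continuous_on {?a..?b} \<gamma>'" and c: "continuous_on {?a..?b} \<phi>"
      using cont' cont sub by (auto intro: continuous_on_subset)
    have "continuous_on {0..?b} (\<lambda>s. \<phi> s * \<gamma>' s)"
      using b m by (intro continuous_on_mult continuous_on_subset[OF cont] continuous_on_subset[OF cont']) auto
    then have "integral {0..?a} (\<lambda>s. \<phi> s * \<gamma>' s) + integral {?a..?b} (\<lambda>s. \<phi> s * \<gamma>' s) = integral {0..?b} (\<lambda>s. \<phi> s * \<gamma>' s)"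
      using b m T by (intro Henstock_Kurzweil_Integration.integral_combine integrable_continuous_real) auto
    moreover have ftc: "(\<gamma>' has_integral (\<gamma> ?b - \<gamma> ?a)) {?a..?b}"
      using T sub by (intro fundamental_theorem_of_calculus)
        (auto intro: has_vector_derivative_within_subset[OF \<gamma>])
    have "((\<lambda>s. \<gamma>' s * \<phi> (\<tau> m) - \<phi> s * \<gamma>' s) has_integral
        ((\<gamma> ?b - \<gamma> ?a) * \<phi> (\<tau> m) - integral {?a..?b} (\<lambda>s. \<phi> s * \<gamma>' s))) {?a..?b}"
      by (intro has_integral_diff has_integral_mult_left ftc integrable_integral
          integrable_continuous_real continuous_on_mult c c')
    then have "cmod ((\<gamma> ?b - \<gamma> ?a) * \<phi> (\<tau> m) - integral {?a..?b} (\<lambda>s. \<phi> s * \<gamma>' s)) \<le> (e * V) * measure lborel {?a..?b}"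
    proof (rule has_integral_bound_real[where S = "{}", rotated 2])
      fix s assume "s \<in> {?a..?b} - {}"
      then have s: "s \<in> {?a..?b}" by simp
      have "cmod (\<phi> (\<tau> m) - \<phi> s) \<le> e"
        using s T sub by (intro e(2)) auto
      moreover have "cmod (\<gamma>' s) \<le> V" using s sub by (intro V) auto
      ultimately have "cmod (\<phi> (\<tau> m) - \<phi> s) * cmod (\<gamma>' s) \<le> e * V" using e(1) by (intro mult_mono) auto
      moreover have "\<gamma>' s * \<phi> (\<tau> m) - \<phi> s * \<gamma>' s = (\<phi> (\<tau> m) - \<phi> s) * \<gamma>' s" by (simp add: algebra_simps)
      ultimately show "cmod (\<gamma>' s * \<phi> (\<tau> m) - \<phi> s * \<gamma>' s) \<le> e * V" by (simp add: norm_mult)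
    qed (use e(1) V0 in simp_all)
    then have "cmod ((\<gamma> ?b - \<gamma> ?a) * \<phi> (\<tau> m) - integral {?a..?b} (\<lambda>s. \<phi> s * \<gamma>' s)) \<le> e * V * (?b - ?a)"
      using T by simp
    moreover have "cmod (stieltjes_sum \<gamma> \<phi> m t \<tau> - integral {0..?a} (\<lambda>s. \<phi> s * \<gamma>' s)) \<le> e * V * ?a"
      using Suc by simp
    ultimately show ?case
      using norm_triangle_ineq[of "stieltjes_sum \<gamma> \<phi> m t \<tau> - integral {0..?a} (\<lambda>s. \<phi> s * \<gamma>' s)"
          "(\<gamma> ?b - \<gamma> ?a) * \<phi> (\<tau> m) - integral {?a..?b} (\<lambda>s. \<phi> s * \<gamma>' s)"]
      by (simp add: stieltjes_sum_def scaleC_complex_def algebra_simps)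
  qed
  from this[of n] show ?thesis using P by (simp add: tagged_partition_def)
qed

lemma stieltjes_sum_converges:
  fixes \<gamma> \<gamma>' \<phi> :: "real \<Rightarrow> complex"
  assumes \<gamma>: "\<And>t. t \<in> {0..1} \<Longrightarrow> (\<gamma> has_vector_derivative \<gamma>' t) (at t within {0..1})"
    and cont': "continuous_on {0..1} \<gamma>'" and V: "\<And>t. t \<in> {0..1} \<Longrightarrow> cmod (\<gamma>' t) \<le> V"
    and cont: "continuous_on {0..1} \<phi>" and B: "\<And>s. s \<in> {0..1} \<Longrightarrow> cmod (\<phi> s) \<le> B"
  obtains I where "cmod I \<le> V * B"
    "\<And>\<epsilon>. 0 < \<epsilon> \<Longrightarrow> \<exists>\<delta>>0. \<forall>n t \<tau>. tagged_partition \<delta> n t \<tau> \<longrightarrow> cmod (stieltjes_sum \<gamma> \<phi> n t \<tau> - I) < \<epsilon>"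
proof
  let ?I = "integral {0..1} (\<lambda>s. \<phi> s * \<gamma>' s)"
  have V0: "0 \<le> V" using order_trans[OF norm_ge_zero V[of 0]] by simp
  have B0: "0 \<le> B" using order_trans[OF norm_ge_zero B[of 0]] by simp
  have "norm ?I \<le> V * B * (1 - 0)"
  proof (rule integral_bound)
    fix s :: real assume s: "s \<in> {0..1}"
    show "norm (\<phi> s * \<gamma>' s) \<le> V * B"
      using mult_mono[OF B[OF s] V[OF s] B0] by (simp add: norm_mult mult.commute)
  qed (simp, intro continuous_on_mult cont cont')
  then show "cmod ?I \<le> V * B" by simp
  fix \<epsilon> :: real assume \<epsilon>: "0 < \<epsilon>"
  (* V may be 0 *)
  define e where "e = \<epsilon> / (V + 1)"
  have e: "0 < e" using \<epsilon> V0 by (simp add: e_def)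
  have "e * V < \<epsilon>" using \<epsilon> V0 by (simp add: e_def field_simps)
  have "uniformly_continuous_on {0..1} \<phi>" by (rule compact_uniformly_continuous[OF cont]) simp
  then obtain \<delta> where \<delta>: "0 < \<delta>" "\<And>u v. u \<in> {0..1} \<Longrightarrow> v \<in> {0..1} \<Longrightarrow> dist v u < \<delta> \<Longrightarrow> dist (\<phi> v) (\<phi> u) < e"
    using e unfolding uniformly_continuous_on_def by blast
  have "cmod (stieltjes_sum \<gamma> \<phi> n t \<tau> - ?I) < \<epsilon>" if P: "tagged_partition \<delta> n t \<tau>" for n t \<tau>
  proof -
    have "cmod (stieltjes_sum \<gamma> \<phi> n t \<tau> - ?I) \<le> e * V"
      using \<delta>(2) e by (intro stieltjes_sum_integral[OF \<gamma> cont' V cont _ _ P])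
        (auto simp: dist_norm less_imp_le)
    then show ?thesis using \<open>e * V < \<epsilon>\<close> by simp
  qed
  then show "\<exists>\<delta>>0. \<forall>n t \<tau>. tagged_partition \<delta> n t \<tau> \<longrightarrow> cmod (stieltjes_sum \<gamma> \<phi> n t \<tau> - ?I) < \<epsilon>"
    using \<delta>(1) by blast
qed

section \<open>Schatten class valued integrals\<close>

definition schatten_integrable :: "real \<Rightarrow> (real \<Rightarrow> complex) \<Rightarrow> (real \<Rightarrow> 'a \<Rightarrow> 'a::chilbert_space) \<Rightarrow> bool"
  where "schatten_integrable p \<gamma> G \<longleftrightarrow>
    (\<exists>I\<in>schatten_class p. \<forall>\<epsilon>>0. \<exists>\<delta>>0. \<forall>n t \<tau>. tagged_partition \<delta> n t \<tau> \<longrightarrow>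
      (\<lambda>x. stieltjes_sum \<gamma> (\<lambda>s. G s x) n t \<tau> - I x) \<in> schatten_class p \<and>
      schatten_sum p (\<lambda>x. stieltjes_sum \<gamma> (\<lambda>s. G s x) n t \<tau> - I x) < \<epsilon>)"

lemma schatten_integrable_cong:
  assumes "\<And>s. s \<in> {0..1} \<Longrightarrow> G s = H s"
  shows "schatten_integrable p \<gamma> G \<longleftrightarrow> schatten_integrable p \<gamma> H"
proof -
  have "stieltjes_sum \<gamma> (\<lambda>s. G s x) n t \<tau> = stieltjes_sum \<gamma> (\<lambda>s. H s x) n t \<tau>"
    if "tagged_partition \<delta> n t \<tau>" for \<delta> n t \<tau> x
    unfolding stieltjes_sum_def
    by (rule sum.cong) (use assms tagged_partition_tags(3)[OF that] in auto)
  then show ?thesis unfolding schatten_integrable_def by (simp cong: imp_cong)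
qed

lemma schatten_integrable_const:
  assumes A: "A \<in> schatten_class p" and p: "0 < p"
  shows "schatten_integrable p \<gamma> (\<lambda>s. A)"
proof -
  have "(\<lambda>x. stieltjes_sum \<gamma> (\<lambda>s. A x) n t \<tau> - (\<gamma> 1 - \<gamma> 0) *\<^sub>C A x) = (\<lambda>x. 0)"
    if "tagged_partition \<delta> n t \<tau>" for \<delta> n t \<tau>
  proof
    fix x
    have "stieltjes_sum \<gamma> (\<lambda>s. A x) n t \<tau> = (\<Sum>j<n. \<gamma> (t (Suc j)) - \<gamma> (t j)) *\<^sub>C A x"
      by (simp add: stieltjes_sum_def complex_vector.scale_sum_left)
    also have "(\<Sum>j<n. \<gamma> (t (Suc j)) - \<gamma> (t j)) = \<gamma> 1 - \<gamma> 0"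
      using that sum_lessThan_telescope[of "\<lambda>j. \<gamma> (t j)" n] by (simp add: tagged_partition_def)
    finally show "stieltjes_sum \<gamma> (\<lambda>s. A x) n t \<tau> - (\<gamma> 1 - \<gamma> 0) *\<^sub>C A x = 0" by simp
  qed
  then show ?thesis
    unfolding schatten_integrable_def
    by (intro bexI[OF _ schatten_class_scaleC(1)[OF A p, of "\<gamma> 1 - \<gamma> 0"]] allI impI exI[of _ 1])
       (simp add: schatten_class_zero)
qed

lemma schatten_integrable_add:
  assumes p: "0 < p" and G: "schatten_integrable p \<gamma> G" and H: "schatten_integrable p \<gamma> H"
  shows "schatten_integrable p \<gamma> (\<lambda>s x. G s x + H s x)"
proof -
  let ?d = "\<lambda>G I n t \<tau> x. stieltjes_sum \<gamma> (\<lambda>s. G s x) n t \<tau> - I x"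
  obtain I where I: "I \<in> schatten_class p" "\<And>\<epsilon>. 0 < \<epsilon> \<Longrightarrow> \<exists>\<delta>>0. \<forall>n t \<tau>. tagged_partition \<delta> n t \<tau> \<longrightarrow>
      ?d G I n t \<tau> \<in> schatten_class p \<and> schatten_sum p (?d G I n t \<tau>) < \<epsilon>"
    using G unfolding schatten_integrable_def by blast
  obtain J where J: "J \<in> schatten_class p" "\<And>\<epsilon>. 0 < \<epsilon> \<Longrightarrow> \<exists>\<delta>>0. \<forall>n t \<tau>. tagged_partition \<delta> n t \<tau> \<longrightarrow>
      ?d H J n t \<tau> \<in> schatten_class p \<and> schatten_sum p (?d H J n t \<tau>) < \<epsilon>"
    using H unfolding schatten_integrable_def by blast
  let ?S = "\<lambda>s x. G s x + H s x" and ?K = "\<lambda>x. I x + J x"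
  have "\<exists>\<delta>>0. \<forall>n t \<tau>. tagged_partition \<delta> n t \<tau> \<longrightarrow>
      ?d ?S ?K n t \<tau> \<in> schatten_class p \<and> schatten_sum p (?d ?S ?K n t \<tau>) < \<epsilon>" if \<epsilon>: "0 < \<epsilon>" for \<epsilon>
  proof -
    define Q where "Q = quasi_constant p"
    have Q: "0 < Q" using quasi_constant_ge_1[OF p] by (simp add: Q_def)
    then have \<epsilon>': "0 < \<epsilon> / (2 * Q)" using \<epsilon> by simp
    obtain \<delta>1 where \<delta>1: "0 < \<delta>1" "\<And>n t \<tau>. tagged_partition \<delta>1 n t \<tau> \<Longrightarrow>
      ?d G I n t \<tau> \<in> schatten_class p \<and> schatten_sum p (?d G I n t \<tau>) < \<epsilon> / (2 * Q)" using I(2)[OF \<epsilon>'] by blast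
    obtain \<delta>2 where \<delta>2: "0 < \<delta>2" "\<And>n t \<tau>. tagged_partition \<delta>2 n t \<tau> \<Longrightarrow>
      ?d H J n t \<tau> \<in> schatten_class p \<and> schatten_sum p (?d H J n t \<tau>) < \<epsilon> / (2 * Q)" using J(2)[OF \<epsilon>'] by blast
    have "?d ?S ?K n t \<tau> \<in> schatten_class p \<and> schatten_sum p (?d ?S ?K n t \<tau>) < \<epsilon>"
      if P: "tagged_partition (min \<delta>1 \<delta>2) n t \<tau>" for n t \<tau>
    proof -
      have g: "?d G I n t \<tau> \<in> schatten_class p" "schatten_sum p (?d G I n t \<tau>) < \<epsilon> / (2 * Q)"
        using \<delta>1(2)[OF tagged_partition_mono[OF P]] by simp_all
      have h: "?d H J n t \<tau> \<in> schatten_class p" "schatten_sum p (?d H J n t \<tau>) < \<epsilon> / (2 * Q)"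
        using \<delta>2(2)[OF tagged_partition_mono[OF P]] by simp_all
      have eq: "?d ?S ?K n t \<tau> = (\<lambda>x. ?d G I n t \<tau> x + ?d H J n t \<tau> x)"
        unfolding stieltjes_sum_def scaleC_add_right sum.distrib by (simp add: algebra_simps)
      have "schatten_sum p (?d ?S ?K n t \<tau>)
          \<le> Q * (schatten_sum p (?d G I n t \<tau>) + schatten_sum p (?d H J n t \<tau>))"
        unfolding eq Q_def by (rule schatten_class_add(2)[OF g(1) h(1) p])
      also have "\<dots> < Q * (\<epsilon> / (2 * Q) + \<epsilon> / (2 * Q))"
        using g(2) h(2) Q by (intro mult_strict_left_mono add_strict_mono)
      also have "\<dots> = \<epsilon>" using Q by simp
      finally show ?thesis
        using schatten_class_add(1)[OF g(1) h(1) p] unfolding eq by blast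
    qed
    then show ?thesis using \<delta>1(1) \<delta>2(1) by (intro exI[of _ "min \<delta>1 \<delta>2"]) simp
  qed
  then show ?thesis
    unfolding schatten_integrable_def
    by (intro bexI[OF _ schatten_class_add(1)[OF I(1) J(1) p]] allI impI)
qed

lemma power_powr_swap:
  fixes a b :: real
  assumes "0 \<le> a"
  shows "(a ^ k) powr b = (a powr b) ^ k"
  by (induction k) (simp_all add: powr_mult assms)

lemma schatten_geometric_series:
  assumes p: "0 < p" and C: "\<And>k. C k \<in> schatten_class p"
    and c: "\<And>k. schatten_sum p (C k) \<le> c * b ^ k" and b: "0 \<le> b" "quasi_constant p * b < 1"
  shows "summable (\<lambda>k. C k x)" "summable (\<lambda>k. quasi_constant p ^ Suc k * schatten_sum p (C k))"
proof -
  let ?Q = "quasi_constant p"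
  note Q = quasi_constant_ge_1[OF p]
  have c0: "0 \<le> c" using c[of 0] schatten_sum_nonneg[OF C, of 0] by simp
  have b1: "b < 1" using b Q mult_right_mono[of 1 ?Q b] by simp
  have "norm (C k x) \<le> c powr (1/p) * norm x * (b powr (1/p)) ^ k" for k
  proof -
    have "schatten_sum p (C k) powr (1/p) \<le> (c * b ^ k) powr (1/p)"
      using p c schatten_sum_nonneg[OF C] by (intro powr_mono2) simp_all
    also have "\<dots> = c powr (1/p) * (b powr (1/p)) ^ k"
      using b c0 by (simp add: powr_mult power_powr_swap)
    finally have "schatten_sum p (C k) powr (1/p) * norm x \<le> c powr (1/p) * (b powr (1/p)) ^ k * norm x"
      by (rule mult_right_mono) simp
    then show ?thesis using norm_le_schatten_sum[OF C p, of k x] by (simp add: mult_ac)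
  qed
  moreover have "summable (\<lambda>k. c powr (1/p) * norm x * (b powr (1/p)) ^ k)"
    using powr_less_mono2[of "1/p" b 1] b(1) b1 p by (intro summable_mult summable_geometric) simp
  ultimately show "summable (\<lambda>k. C k x)" by (rule summable_comparison_test'[where N = 0, rotated])
  have "norm (?Q ^ Suc k * schatten_sum p (C k)) \<le> ?Q * c * (?Q * b) ^ k" for k
  proof -
    have "?Q ^ Suc k * schatten_sum p (C k) \<le> ?Q ^ Suc k * (c * b ^ k)"
      using Q by (intro mult_left_mono c) simp
    then show ?thesis using Q schatten_sum_nonneg[OF C, of k] by (simp add: power_mult_distrib mult_ac abs_mult)
  qed
  moreover have "summable (\<lambda>k. ?Q * c * (?Q * b) ^ k)"
    using b Q by (intro summable_mult summable_geometric) simp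
  ultimately show "summable (\<lambda>k. ?Q ^ Suc k * schatten_sum p (C k))"
    by (rule summable_comparison_test'[where N = 0, rotated])
qed

lemma uniform_mesh:
  fixes N :: nat
  assumes "\<And>k. \<exists>\<delta>>0. \<forall>n t \<tau>. tagged_partition \<delta> n t \<tau> \<longrightarrow> R k n t \<tau>"
  shows "\<exists>\<delta>>0. \<forall>n t \<tau>. tagged_partition \<delta> n t \<tau> \<longrightarrow> (\<forall>k<N. R k n t \<tau>)"
proof (induction N)
  case 0
  then show ?case by (auto intro: exI[of _ 1])
next
  case (Suc N)
  obtain \<delta>1 where \<delta>1: "0 < \<delta>1" "\<And>n t \<tau>. tagged_partition \<delta>1 n t \<tau> \<Longrightarrow> \<forall>k<N. R k n t \<tau>"
    using Suc by blast
  obtain \<delta>2 where \<delta>2: "0 < \<delta>2" "\<And>n t \<tau>. tagged_partition \<delta>2 n t \<tau> \<Longrightarrow> R N n t \<tau>"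
    using assms[of N] by blast
  have "\<forall>k<Suc N. R k n t \<tau>" if "tagged_partition (min \<delta>1 \<delta>2) n t \<tau>" for n t \<tau>
    using \<delta>1(2)[OF tagged_partition_mono[OF that]] \<delta>2(2)[OF tagged_partition_mono[OF that]]
    by (simp add: less_Suc_eq)
  then show ?case using \<delta>1(1) \<delta>2(1) by (intro exI[of _ "min \<delta>1 \<delta>2"]) simp
qed

text \<open>
  The Riemann sums of \<open>G\<close> minus the candidate integral are the series of the operators \<open>A k\<close> with the
  errors of the scalar Riemann sums of \<open>\<phi> k\<close> as coefficients.  Each error tends to 0 with the mesh and
  is bounded by a multiple of \<open>r ^ k\<close> for every partition, so dominated convergence for series applies:
  the tail from \<open>N\<close> on is small for all partitions, and the first \<open>N\<close> terms for small mesh.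
\<close>

lemma schatten_integrable_series:
  fixes \<gamma> \<gamma>' :: "real \<Rightarrow> complex" and \<phi> :: "nat \<Rightarrow> real \<Rightarrow> complex"
  assumes p: "0 < p"
    and \<gamma>: "\<And>t. t \<in> {0..1} \<Longrightarrow> (\<gamma> has_vector_derivative \<gamma>' t) (at t within {0..1})"
    and cont': "continuous_on {0..1} \<gamma>'"
    and cont: "\<And>k. continuous_on {0..1} (\<phi> k)" and r: "\<And>k s. s \<in> {0..1} \<Longrightarrow> cmod (\<phi> k s) \<le> r ^ k"
    and A: "\<And>k. A k \<in> schatten_class p" and c: "\<And>k. schatten_sum p (A k) \<le> c * D ^ k"
    and D: "0 \<le> D" "0 \<le> r" "quasi_constant p * (r powr p * D) < 1"
    and G: "\<And>s x. s \<in> {0..1} \<Longrightarrow> (\<lambda>k. \<phi> k s *\<^sub>C A k x) sums G s x"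
  shows "schatten_integrable p \<gamma> G"
proof -
  let ?Q = "quasi_constant p"
  note Q = quasi_constant_ge_1[OF p]
  have c0: "0 \<le> c" using c[of 0] schatten_sum_nonneg[OF A, of 0] by simp
  define b where "b = r powr p * D"
  have b: "0 \<le> b" "?Q * b < 1" using D by (simp_all add: b_def)
  (* V bounds the speed of the curve, so V * r ^ k bounds all Riemann sums of \<phi> k and their limits *)
  have "compact (\<gamma>' ` {0..1})" by (rule compact_continuous_image[OF cont']) simp
  then obtain V where V: "\<And>t. t \<in> {0..1} \<Longrightarrow> cmod (\<gamma>' t) \<le> V"
    using compact_imp_bounded bounded_iff by (metis image_eqI)
  have V0: "0 \<le> V" using order_trans[OF norm_ge_zero V[of 0]] by simp
  note lip = C1_curve_lipschitz[OF \<gamma> V]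
  have "\<exists>I. cmod I \<le> V * r ^ k \<and> (\<forall>\<epsilon>>0. \<exists>\<delta>>0. \<forall>n t \<tau>. tagged_partition \<delta> n t \<tau> \<longrightarrow>
      cmod (stieltjes_sum \<gamma> (\<phi> k) n t \<tau> - I) < \<epsilon>)" for k
    using stieltjes_sum_converges[OF \<gamma> cont' V cont r, of k] by metis
  then obtain I where I: "\<And>k. cmod (I k) \<le> V * r ^ k"
    "\<And>k \<epsilon>. 0 < \<epsilon> \<Longrightarrow> \<exists>\<delta>>0. \<forall>n t \<tau>. tagged_partition \<delta> n t \<tau> \<longrightarrow> cmod (stieltjes_sum \<gamma> (\<phi> k) n t \<tau> - I k) < \<epsilon>"
    by metis
  have scaled: "(\<lambda>x. w *\<^sub>C A k x) \<in> schatten_class p"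
    "schatten_sum p (\<lambda>x. w *\<^sub>C A k x) \<le> (u powr p * c) * b ^ k" if w: "cmod w \<le> u * r ^ k" "0 \<le> u" for w u k
  proof -
    show "(\<lambda>x. w *\<^sub>C A k x) \<in> schatten_class p" by (rule schatten_class_scaleC(1)[OF A p])
    have "schatten_sum p (\<lambda>x. w *\<^sub>C A k x) \<le> cmod w powr p * schatten_sum p (A k)"
      by (rule schatten_class_scaleC(2)[OF A p])
    also have "\<dots> \<le> (u * r ^ k) powr p * (c * D ^ k)"
      using w p by (intro mult_mono powr_mono2 c schatten_sum_nonneg A) simp_all
    also have "\<dots> = (u powr p * c) * b ^ k"
      using w(2) D by (simp add: b_def powr_mult power_mult_distrib power_powr_swap mult_ac)
    finally show "schatten_sum p (\<lambda>x. w *\<^sub>C A k x) \<le> (u powr p * c) * b ^ k" .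
  qed
  let ?I = "\<lambda>x. \<Sum>k. I k *\<^sub>C A k x"
  note geoI = schatten_geometric_series[OF p scaled[OF I(1) V0] b]
  have sumsI: "(\<lambda>k. I k *\<^sub>C A k x) sums ?I x" for x by (rule summable_sums[OF geoI(1)])
  have I_mem: "?I \<in> schatten_class p"
    by (rule schatten_class_series(1)[OF p scaled(1)[OF I(1) V0] geoI(2) sumsI])
  let ?d = "\<lambda>n t \<tau> k. stieltjes_sum \<gamma> (\<phi> k) n t \<tau> - I k"
  let ?E = "\<lambda>n t \<tau> x. stieltjes_sum \<gamma> (\<lambda>s. G s x) n t \<tau> - ?I x"
  have err: "?E n t \<tau> \<in> schatten_class p"
    "schatten_sum p (?E n t \<tau>) \<le> (\<Sum>k. ?Q ^ Suc k * schatten_sum p (\<lambda>x. ?d n t \<tau> k *\<^sub>C A k x))"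
    "summable (\<lambda>k. ?Q ^ Suc k * schatten_sum p (\<lambda>x. ?d n t \<tau> k *\<^sub>C A k x))"
    "cmod (?d n t \<tau> k) \<le> 2 * V * r ^ k"
    if P: "tagged_partition \<delta> n t \<tau>" for \<delta> n t \<tau> k
  proof -
    have d: "cmod (?d n t \<tau> k) \<le> 2 * V * r ^ k" for k
    proof -
      have "cmod (stieltjes_sum \<gamma> (\<phi> k) n t \<tau>) \<le> V * r ^ k"
        by (rule stieltjes_sum_bound[OF P lip V0 r])
      then show ?thesis
        using I(1)[of k] norm_triangle_ineq4[of "stieltjes_sum \<gamma> (\<phi> k) n t \<tau>" "I k"] by simp
    qed
    then show "cmod (?d n t \<tau> k) \<le> 2 * V * r ^ k" .
    have V2: "0 \<le> 2 * V" using V0 by simp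
    note mem = scaled(1)[OF d V2]
    note geo = schatten_geometric_series(2)[OF p mem scaled(2)[OF d V2] b]
    then show "summable (\<lambda>k. ?Q ^ Suc k * schatten_sum p (\<lambda>x. ?d n t \<tau> k *\<^sub>C A k x))" .
    have "(\<lambda>k. ?d n t \<tau> k *\<^sub>C A k x) sums ?E n t \<tau> x" for x
    proof -
      have "(\<lambda>k. (\<gamma> (t (Suc j)) - \<gamma> (t j)) *\<^sub>C \<phi> k (\<tau> j) *\<^sub>C A k x) sums
          ((\<gamma> (t (Suc j)) - \<gamma> (t j)) *\<^sub>C G (\<tau> j) x)" if "j < n" for j
        by (rule bounded_linear.sums[OF bounded_clinearD(1)[OF bounded_clinear_scaleC]
              G[OF tagged_partition_tags(3)[OF P that]]])
      then have "(\<lambda>k. \<Sum>j<n. (\<gamma> (t (Suc j)) - \<gamma> (t j)) *\<^sub>C \<phi> k (\<tau> j) *\<^sub>C A k x) sums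
          stieltjes_sum \<gamma> (\<lambda>s. G s x) n t \<tau>"
        unfolding stieltjes_sum_def by (intro sums_sum) simp
      moreover have "(\<Sum>j<n. (\<gamma> (t (Suc j)) - \<gamma> (t j)) *\<^sub>C \<phi> k (\<tau> j) *\<^sub>C A k x) =
          stieltjes_sum \<gamma> (\<phi> k) n t \<tau> *\<^sub>C A k x" for k
        by (simp add: stieltjes_sum_def scaleC_complex_def scaleC_scaleC complex_vector.scale_sum_left)
      ultimately have "(\<lambda>k. stieltjes_sum \<gamma> (\<phi> k) n t \<tau> *\<^sub>C A k x - I k *\<^sub>C A k x) sums ?E n t \<tau> x"
        using sums_diff[OF _ sumsI] by simp
      then show ?thesis by (simp add: complex_vector.scale_left_diff_distrib)
    qed
    note * = schatten_class_series[OF p mem geo this]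
    show "?E n t \<tau> \<in> schatten_class p" by (rule *(1))
    show "schatten_sum p (?E n t \<tau>) \<le> (\<Sum>k. ?Q ^ Suc k * schatten_sum p (\<lambda>x. ?d n t \<tau> k *\<^sub>C A k x))"
      by (rule *(2))
  qed
  have "\<exists>\<delta>>0. \<forall>n t \<tau>. tagged_partition \<delta> n t \<tau> \<longrightarrow>
      ?E n t \<tau> \<in> schatten_class p \<and> schatten_sum p (?E n t \<tau>) < \<epsilon>" if \<epsilon>: "0 < \<epsilon>" for \<epsilon>
  proof -
    let ?M = "\<lambda>k. ?Q * ((2 * V) powr p * c) * (?Q * b) ^ k"
    have summM: "summable ?M"
      using b Q by (intro summable_mult summable_geometric) simp
    obtain N where N: "norm (\<Sum>k. ?M (k + N)) < \<epsilon> / 2"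
      using suminf_exist_split[OF _ summM, of "\<epsilon>/2"] \<epsilon> by auto
    define K where "K = (\<Sum>k<N. ?Q ^ Suc k * (c * D ^ k))"
    have K0: "0 \<le> K" unfolding K_def using Q c0 D(1) by (intro sum_nonneg mult_nonneg_nonneg) simp_all
    (* errors below \<eta> in the first N coefficients contribute less than \<epsilon>/2 *)
    define \<eta> where "\<eta> = (\<epsilon> / (2 * (K + 1))) powr (1/p)"
    have \<eta>0: "0 < \<eta>" using \<epsilon> K0 by (simp add: \<eta>_def)
    have \<eta>K: "K * \<eta> powr p < \<epsilon> / 2"
    proof -
      have "\<eta> powr p = \<epsilon> / (2 * (K + 1))" using p \<epsilon> K0 by (simp add: \<eta>_def powr_powr)
      then have "K * \<eta> powr p + \<eta> powr p = \<epsilon> / 2" using K0 by (simp add: field_simps)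
      moreover have "0 < \<eta> powr p" using \<eta>0 by simp
      ultimately show ?thesis by linarith
    qed
    obtain \<delta> where \<delta>: "0 < \<delta>"
      "\<And>n t \<tau>. tagged_partition \<delta> n t \<tau> \<Longrightarrow> \<forall>k<N. cmod (?d n t \<tau> k) < \<eta>"
      using uniform_mesh[of "\<lambda>k n t \<tau>. cmod (?d n t \<tau> k) < \<eta>" N] I(2)[OF \<eta>0] by blast
    have "schatten_sum p (?E n t \<tau>) < \<epsilon>" if P: "tagged_partition \<delta> n t \<tau>" for n t \<tau>
    proof -
      let ?a = "\<lambda>k. ?Q ^ Suc k * schatten_sum p (\<lambda>x. ?d n t \<tau> k *\<^sub>C A k x)"
      have "(\<Sum>k<N. ?a k) \<le> (\<Sum>k<N. ?Q ^ Suc k * (c * D ^ k) * \<eta> powr p)"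
      proof (rule sum_mono)
        fix k assume k: "k \<in> {..<N}"
        have "schatten_sum p (\<lambda>x. ?d n t \<tau> k *\<^sub>C A k x) \<le> cmod (?d n t \<tau> k) powr p * schatten_sum p (A k)"
          by (rule schatten_class_scaleC(2)[OF A p])
        also have "\<dots> \<le> \<eta> powr p * (c * D ^ k)"
          using \<delta>(2)[OF P] k p by (intro mult_mono powr_mono2 c schatten_sum_nonneg A) (simp_all add: less_imp_le)
        finally show "?a k \<le> ?Q ^ Suc k * (c * D ^ k) * \<eta> powr p"
          using Q by (simp add: mult_ac mult_left_mono)
      qed
      also have "\<dots> = K * \<eta> powr p" by (simp add: K_def sum_distrib_right)
      also note \<eta>K
      finally have head: "(\<Sum>k<N. ?a k) < \<epsilon> / 2" .
      have "?a k \<le> ?M k" for k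
      proof -
        have "?a k \<le> ?Q ^ Suc k * (((2 * V) powr p * c) * b ^ k)"
          using Q V0 by (intro mult_left_mono scaled(2) err(4)[OF P]) simp_all
        then show ?thesis by (simp add: power_mult_distrib mult_ac)
      qed
      then have "(\<Sum>k. ?a (k + N)) \<le> (\<Sum>k. ?M (k + N))"
        by (intro suminf_le summable_ignore_initial_segment summM err(3)[OF P])
      then have tail: "(\<Sum>k. ?a (k + N)) < \<epsilon> / 2" using N by simp
      have "schatten_sum p (?E n t \<tau>) \<le> suminf ?a" by (rule err(2)[OF P])
      also have "suminf ?a = (\<Sum>k. ?a (k + N)) + (\<Sum>k<N. ?a k)"
        by (rule suminf_split_initial_segment[OF err(3)[OF P]])
      also have "\<dots> < \<epsilon>" using head tail by simp
      finally show ?thesis .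
    qed
    then show ?thesis using \<delta>(1) err(1) by blast
  qed
  then show ?thesis unfolding schatten_integrable_def by (intro bexI[OF _ I_mem] allI impI)
qed

section \<open>The resolvent\<close>

lemma resolvent:
  assumes "z \<notin> spectrum S"
  shows bounded_clinear_resolvent: "bounded_clinear (resolvent S z)"
    and resolvent_left: "resolvent S z (z *\<^sub>C x - S x) = x"
    and resolvent_right: "z *\<^sub>C resolvent S z x - S (resolvent S z x) = x"
proof -
  obtain R where R: "bounded_clinear R" "\<And>x. R (z *\<^sub>C x - S x) = x" "\<And>x. z *\<^sub>C R x - S (R x) = x"
    using assms unfolding spectrum_def by blast
  then have "resolvent S z = R"
    unfolding resolvent_def by (intro inv_equality)
  with R show "bounded_clinear (resolvent S z)" "resolvent S z (z *\<^sub>C x - S x) = x"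
    "z *\<^sub>C resolvent S z x - S (resolvent S z x) = x" by simp_all
qed

text \<open>
  Multiply \<open>T (z - S) - (z - S) T = S T - T S\<close> by the resolvent on both sides.
\<close>

lemma commutator_resolvent:
  assumes T: "bounded_clinear T" and z: "z \<notin> spectrum S"
  shows "commutator (resolvent S z) T = (\<lambda>x. resolvent S z (commutator S T (resolvent S z x)))"
proof
  fix x
  let ?R = "resolvent S z"
  let ?y = "?R x"
  note R = bounded_clinear_resolvent[OF z]
  have "T x = T (z *\<^sub>C ?y - S ?y)" by (simp add: resolvent_right[OF z])
  then have "commutator S T ?y = T x - (z *\<^sub>C T ?y - S (T ?y))"
    by (simp add: commutator_def bounded_clinearD(2,4)[OF T])
  then have "?R (commutator S T ?y) = ?R (T x) - ?R (z *\<^sub>C T ?y - S (T ?y))"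
    by (simp only: bounded_clinearD(4)[OF R])
  then show "commutator ?R T x = ?R (commutator S T ?y)"
    by (simp add: commutator_def resolvent_left[OF z])
qed

lemma bounded_clinear_funpow: "bounded_clinear R \<Longrightarrow> bounded_clinear (R ^^ k)"
proof (induction k)
  case 0
  then show ?case using bounded_clinear_id by (simp add: id_def)
next
  case (Suc k)
  then show ?case using bounded_clinear_compose[of R "R ^^ k"] by (simp add: comp_def)
qed

lemma norm_funpow_le:
  fixes R :: "'a::real_normed_vector \<Rightarrow> 'a"
  assumes "\<And>x. norm (R x) \<le> M * norm x" "0 \<le> M"
  shows "norm ((R ^^ k) x) \<le> M ^ k * norm x"
proof (induction k)
  case (Suc k)
  have "norm (R ((R ^^ k) x)) \<le> M * (M ^ k * norm x)"
    by (rule order_trans[OF assms(1) mult_left_mono[OF Suc assms(2)]])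
  then show ?case by simp
qed simp

text \<open>
  The resolvent identity \<open>R z = R z0 + (z0 - z) R z0 (R z)\<close>, iterated.  Both points are already known to
  lie in the resolvent set, so only the remainder has to be estimated.
\<close>

lemma resolvent_power_series:
  assumes z0: "z0 \<notin> spectrum S" and z: "z \<notin> spectrum S"
    and M: "\<And>x. norm (resolvent S z0 x) \<le> M * norm x" "0 \<le> M" and small: "cmod (z0 - z) * M < 1"
  shows "(\<lambda>k. (z0 - z) ^ k *\<^sub>C (resolvent S z0 ^^ Suc k) x) sums resolvent S z x"
proof -
  let ?R = "resolvent S z0" and ?w = "z0 - z" and ?y = "resolvent S z x"
  note R = bounded_clinear_resolvent[OF z0]
  have step: "?y = ?R x + ?w *\<^sub>C ?R ?y"
  proof -
    have "x = z *\<^sub>C ?y - S ?y" by (simp add: resolvent_right[OF z])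
    also have "\<dots> = (z0 *\<^sub>C ?y - S ?y) - ?w *\<^sub>C ?y"
      by (simp add: complex_vector.scale_left_diff_distrib)
    finally have "?R x = ?R ((z0 *\<^sub>C ?y - S ?y) - ?w *\<^sub>C ?y)" by (rule arg_cong)
    also have "\<dots> = ?R (z0 *\<^sub>C ?y - S ?y) - ?w *\<^sub>C ?R ?y"
      by (simp only: bounded_clinearD(2)[OF R] bounded_clinearD(4)[OF R, of _ "?w *\<^sub>C ?y"])
    finally have "?R x = ?R (z0 *\<^sub>C ?y - S ?y) - ?w *\<^sub>C ?R ?y" .
    then show ?thesis by (simp add: resolvent_left[OF z0])
  qed
  have expand: "?y - (\<Sum>k<n. ?w ^ k *\<^sub>C (?R ^^ Suc k) x) = ?w ^ n *\<^sub>C (?R ^^ n) ?y" for n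
  proof (induction n)
    case (Suc n)
    have "(?R ^^ n) ?y = (?R ^^ n) (?R x + ?w *\<^sub>C ?R ?y)" using step by simp
    also have "\<dots> = (?R ^^ Suc n) x + ?w *\<^sub>C (?R ^^ Suc n) ?y"
      by (simp add: bounded_clinearD(2,3)[OF bounded_clinear_funpow[OF R]] funpow_swap1)
    finally have "?w ^ n *\<^sub>C (?R ^^ n) ?y = ?w ^ n *\<^sub>C (?R ^^ Suc n) x + ?w ^ Suc n *\<^sub>C (?R ^^ Suc n) ?y"
      by (simp only: scaleC_add_right scaleC_scaleC power_Suc2)
    note R_pow = this
    have "?y - (\<Sum>k<Suc n. ?w ^ k *\<^sub>C (?R ^^ Suc k) x) =
        (?y - (\<Sum>k<n. ?w ^ k *\<^sub>C (?R ^^ Suc k) x)) - ?w ^ n *\<^sub>C (?R ^^ Suc n) x"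
      by (simp del: funpow.simps)
    also have "\<dots> = ?w ^ Suc n *\<^sub>C (?R ^^ Suc n) ?y"
      unfolding Suc.IH R_pow by (rule add_diff_cancel_left')
    finally show ?case .
  qed simp
  have "(\<lambda>n. ?y - (\<Sum>k<n. ?w ^ k *\<^sub>C (?R ^^ Suc k) x)) \<longlonglongrightarrow> 0"
  proof (rule Lim_null_comparison[OF always_eventually], rule allI)
    fix n
    have "cmod ?w ^ n * norm ((?R ^^ n) ?y) \<le> cmod ?w ^ n * (M ^ n * norm ?y)"
      by (intro mult_left_mono norm_funpow_le M) simp
    then show "norm (?y - (\<Sum>k<n. ?w ^ k *\<^sub>C (?R ^^ Suc k) x)) \<le> (cmod ?w * M) ^ n * norm ?y"
      unfolding expand by (simp add: norm_scaleC norm_power power_mult_distrib mult.assoc)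
    have "(\<lambda>n. (cmod ?w * M) ^ n * norm ?y) \<longlonglongrightarrow> 0 * norm ?y"
      using small M(2) by (intro tendsto_intros LIMSEQ_power_zero) simp
    then show "(\<lambda>n. (cmod ?w * M) ^ n * norm ?y) \<longlonglongrightarrow> 0" by simp
  qed
  then have "(\<lambda>n. ?y - (?y - (\<Sum>k<n. ?w ^ k *\<^sub>C (?R ^^ Suc k) x))) \<longlonglongrightarrow> ?y - 0"
    by (intro tendsto_diff tendsto_const)
  then show ?thesis unfolding sums_def by simp
qed

text \<open>
  The Leibniz rule \<open>[R ^ (k + 2), T] = R [R ^ (k + 1), T] + [R, T] R ^ (k + 1)\<close> gives the geometric bound
  by induction: after multiplication by the quasi-triangle constant, each of the two summands
  contributes at most half of the claimed bound.
\<close>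

lemma schatten_commutator_power:
  assumes p: "0 < p" and R: "bounded_clinear R" and T: "bounded_clinear T"
    and M: "\<And>x. norm (R x) \<le> M * norm x" "0 \<le> M" and RT: "commutator R T \<in> schatten_class p"
  shows "commutator (R ^^ Suc k) T \<in> schatten_class p \<and>
    schatten_sum p (commutator (R ^^ Suc k) T)
      \<le> schatten_sum p (commutator R T) * (2 * quasi_constant p * M powr p) ^ k"
proof (induction k)
  case 0
  then show ?case using RT by simp
next
  case (Suc k)
  let ?Q = "quasi_constant p" and ?q = "schatten_sum p (commutator R T)"
  let ?D = "2 * ?Q * M powr p"
  let ?B = "commutator (R ^^ Suc k) T"
  have Q: "1 \<le> ?Q" by (rule quasi_constant_ge_1[OF p])
  have q: "0 \<le> ?q" by (rule schatten_sum_nonneg[OF RT])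
  have eq: "commutator (R ^^ Suc (Suc k)) T = (\<lambda>x. R (?B x) + commutator R T ((R ^^ Suc k) x))"
    by (simp add: commutator_def bounded_clinearD(4)[OF R])
  note B = conjunct1[OF Suc.IH] conjunct2[OF Suc.IH]
  note L = schatten_class_compose_left[OF B(1) R p M(2,1)]
  have Mk: "norm ((R ^^ Suc k) x) \<le> M ^ Suc k * norm x" for x by (rule norm_funpow_le[OF M])
  have Mk0: "0 \<le> M ^ Suc k" using M(2) by simp
  note C = schatten_class_compose_right[OF RT bounded_clinear_funpow[OF R] p Mk0 Mk]
  have "(M ^ Suc k) powr p = M powr p * (M powr p) ^ k"
    by (simp add: power_powr_swap[OF M(2)] del: power_Suc add: power_Suc[symmetric])
  also have "\<dots> \<le> M powr p * ?D ^ k"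
    using Q mult_right_mono[of 1 "2 * ?Q" "M powr p"] by (intro mult_left_mono power_mono) simp_all
  finally have Mp: "(M ^ Suc k) powr p \<le> M powr p * ?D ^ k" .
  have "schatten_sum p (commutator (R ^^ Suc (Suc k)) T)
      \<le> ?Q * (schatten_sum p (\<lambda>x. R (?B x)) + schatten_sum p (\<lambda>x. commutator R T ((R ^^ Suc k) x)))"
    unfolding eq by (rule schatten_class_add(2)[OF L(1) C(1) p])
  also have "\<dots> \<le> ?Q * (M powr p * (?q * ?D ^ k) + (M powr p * ?D ^ k) * ?q)"
  proof (intro mult_left_mono add_mono)
    show "schatten_sum p (\<lambda>x. R (?B x)) \<le> M powr p * (?q * ?D ^ k)"
      by (rule order_trans[OF L(2) mult_left_mono[OF B(2)]]) simp
    show "schatten_sum p (\<lambda>x. commutator R T ((R ^^ Suc k) x)) \<le> (M powr p * ?D ^ k) * ?q"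
      by (rule order_trans[OF C(2) mult_right_mono[OF Mp q]])
  qed (use Q in simp)
  also have "\<dots> = ?q * ?D ^ Suc k" by (simp add: algebra_simps)
  finally show ?case using schatten_class_add(1)[OF L(1) C(1) p] unfolding eq by blast
qed

text \<open>
  Constant extension of a function from \<open>{a..b}\<close> to \<open>{0..1}\<close>: with it, integrability over a subinterval is
  expressed by partitions of the whole interval, which need not contain \<open>a\<close> and \<open>b\<close>.
\<close>

definition clamp_real :: "real \<Rightarrow> real \<Rightarrow> real \<Rightarrow> real"
  where "clamp_real a b s = max a (min b s)"

lemma clamp_real:
  assumes "a \<le> b"
  shows "a \<le> clamp_real a b s" "clamp_real a b s \<le> b"
  using assms by (auto simp: clamp_real_def)

lemma continuous_on_clamp_real: "continuous_on X (clamp_real a b)"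
  unfolding clamp_real_def by (intro continuous_intros)

text \<open>
  Near \<open>\<gamma> u\<close> the commutators have the power series with coefficients \<open>[R ^ (k + 1), T]\<close>, whose quasi-norms
  grow at most geometrically.  The radius \<open>r\<close> ensures convergence of the resolvent series (first
  entry of the minimum) and of the series of quasi-norms with its weights (second entry).
\<close>

lemma locally_schatten_integrable:
  fixes \<gamma> \<gamma>' :: "real \<Rightarrow> complex"
  assumes p: "0 < p"
    and \<gamma>: "\<And>t. t \<in> {0..1} \<Longrightarrow> (\<gamma> has_vector_derivative \<gamma>' t) (at t within {0..1})"
    and cont': "continuous_on {0..1} \<gamma>'"
    and T: "bounded_clinear T" and spec: "\<And>s. s \<in> {0..1} \<Longrightarrow> \<gamma> s \<notin> spectrum S"
    and F: "\<And>s. s \<in> {0..1} \<Longrightarrow> commutator (resolvent S (\<gamma> s)) T \<in> schatten_class p"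
    and u: "u \<in> {0..1}"
  shows "\<exists>d>0. \<forall>a b. 0 \<le> a \<and> a \<le> u \<and> u \<le> b \<and> b \<le> 1 \<and> b - a < d \<longrightarrow>
    schatten_integrable p \<gamma> (\<lambda>s. commutator (resolvent S (\<gamma> (clamp_real a b s))) T)"
proof -
  let ?Q = "quasi_constant p"
  define R where "R = resolvent S (\<gamma> u)"
  have R: "bounded_clinear R" unfolding R_def by (rule bounded_clinear_resolvent[OF spec[OF u]])
  obtain M where M: "0 < M" "\<And>x. norm (R x) \<le> M * norm x" using bounded_clinear_bound[OF R] by blast
  have M0: "0 \<le> M" using M(1) by simp
  define D where "D = 2 * ?Q * M powr p"
  have Q: "1 \<le> ?Q" by (rule quasi_constant_ge_1[OF p])
  have D: "0 < D" unfolding D_def using Q M(1) by simp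
  define r where "r = min (1 / (2 * M)) ((1 / (2 * ?Q * D)) powr (1/p))"
  have r: "0 < r" unfolding r_def using M(1) D Q by simp
  have rM: "r * M < 1"
  proof -
    have "r * M \<le> 1 / (2 * M) * M" unfolding r_def using M0 by (intro mult_right_mono) simp_all
    then show ?thesis using M(1) by simp
  qed
  have "r powr p \<le> ((1 / (2 * ?Q * D)) powr (1/p)) powr p"
    using r p unfolding r_def by (intro powr_mono2) simp_all
  also have "\<dots> = 1 / (2 * ?Q * D)" using p Q D by (simp add: powr_powr)
  finally have rp: "?Q * (r powr p * D) < 1" using Q D by (simp add: field_simps)
  have cont: "continuous_on {0..1} \<gamma>"
    using \<gamma> by (meson continuous_on_eq_continuous_within has_vector_derivative_continuous)
  then obtain d where d: "0 < d" "\<And>s. s \<in> {0..1} \<Longrightarrow> dist s u < d \<Longrightarrow> dist (\<gamma> s) (\<gamma> u) < r"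
    using u r unfolding continuous_on_iff by blast
  have "schatten_integrable p \<gamma> (\<lambda>s. commutator (resolvent S (\<gamma> (clamp_real a b s))) T)"
    if ab: "0 \<le> a" "a \<le> u" "u \<le> b" "b \<le> 1" "b - a < d" for a b
  proof -
    let ?c = "clamp_real a b"
    have "a \<le> b" using ab by simp
    note c = clamp_real[OF this]
    have c01: "?c s \<in> {0..1}" for s using c[of s] ab by simp
    have near: "cmod (\<gamma> u - \<gamma> (?c s)) \<le> r" for s
    proof -
      have "dist (?c s) u < d" using c[of s] ab by (simp add: dist_real_def abs_if)
      then show ?thesis using d(2)[OF c01] by (simp add: dist_norm norm_minus_commute less_imp_le)
    qed
    have cont_c: "continuous_on {0..1} (\<lambda>s. \<gamma> (?c s))"
      using c01 by (intro continuous_on_compose2[OF cont continuous_on_clamp_real]) auto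
    have RT: "commutator R T \<in> schatten_class p" unfolding R_def by (rule F[OF u])
    note B = schatten_commutator_power[OF p R T M(2) M0 RT, folded D_def]
    show ?thesis
    proof (rule schatten_integrable_series[where \<gamma>' = \<gamma>' and \<phi> = "\<lambda>k s. (\<gamma> u - \<gamma> (?c s)) ^ k"
          and A = "\<lambda>k. commutator (R ^^ Suc k) T" and r = r and D = D
          and c = "schatten_sum p (commutator R T)"])
      show "continuous_on {0..1} (\<lambda>s. (\<gamma> u - \<gamma> (?c s)) ^ k)" for k
        by (intro continuous_intros cont_c)
      show "cmod ((\<gamma> u - \<gamma> (?c s)) ^ k) \<le> r ^ k" for k s
        unfolding norm_power by (rule power_mono[OF near]) simp
      show "commutator (R ^^ Suc k) T \<in> schatten_class p" for k using B[of k] by simp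
      show "schatten_sum p (commutator (R ^^ Suc k) T) \<le> schatten_sum p (commutator R T) * D ^ k" for k
        using B[of k] by simp
      show "(\<lambda>k. (\<gamma> u - \<gamma> (?c s)) ^ k *\<^sub>C commutator (R ^^ Suc k) T x) sums
          commutator (resolvent S (\<gamma> (?c s))) T x" for s x
      proof -
        have small: "cmod (\<gamma> u - \<gamma> (?c s)) * M < 1"
          using mult_right_mono[OF near[of s] M0] rM by linarith
        note ser = resolvent_power_series[OF spec[OF u] spec[OF c01[of s]], folded R_def, OF M(2) M0 small]
        show ?thesis
          using sums_diff[OF ser[of "T x"] bounded_linear.sums[OF bounded_clinearD(1)[OF T] ser[of x]]]
          by (simp add: commutator_def bounded_clinearD(2)[OF T] complex_vector.scale_right_diff_distrib)
      qed
    qed (use p \<gamma> cont' D r rp in simp_all)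
  qed
  then show ?thesis using d(1) by blast
qed

text \<open>
  Bisection from the local statement.  Adjacent intervals are glued by
  \<open>F (clamp a c s) = F (clamp a b s) + F (clamp b c s) - F b\<close>.
\<close>

lemma schatten_integrable_commutator_resolvent:
  fixes \<gamma> \<gamma>' :: "real \<Rightarrow> complex"
  assumes p: "0 < p"
    and \<gamma>: "\<And>t. t \<in> {0..1} \<Longrightarrow> (\<gamma> has_vector_derivative \<gamma>' t) (at t within {0..1})"
    and cont': "continuous_on {0..1} \<gamma>'"
    and T: "bounded_clinear T" and spec: "\<And>s. s \<in> {0..1} \<Longrightarrow> \<gamma> s \<notin> spectrum S"
    and F: "\<And>s. s \<in> {0..1} \<Longrightarrow> commutator (resolvent S (\<gamma> s)) T \<in> schatten_class p"
  shows "schatten_integrable p \<gamma> (\<lambda>s. commutator (resolvent S (\<gamma> s)) T)"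
proof -
  let ?F = "\<lambda>s. commutator (resolvent S (\<gamma> s)) T"
  define P where "P a b \<longleftrightarrow> (0 \<le> a \<and> a \<le> b \<and> b \<le> 1 \<longrightarrow>
    schatten_integrable p \<gamma> (\<lambda>s. ?F (clamp_real a b s)))" for a b
  have "P 0 1"
  proof (rule Bolzano)
    show "(0::real) \<le> 1" by simp
  next
    fix a b c :: real assume P: "P a b" "P b c" and le: "a \<le> b" "b \<le> c"
    show "P a c"
      unfolding P_def
    proof
      assume ac: "0 \<le> a \<and> a \<le> c \<and> c \<le> 1"
      have b: "b \<in> {0..1}" using ac le by simp
      have "schatten_integrable p \<gamma> (\<lambda>s x. ?F (clamp_real a b s) x + ?F (clamp_real b c s) x)"
        using P ac le unfolding P_def by (intro schatten_integrable_add p) simp_all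
      moreover have "schatten_integrable p \<gamma> (\<lambda>s x. (-1) *\<^sub>C ?F b x)"
        by (intro schatten_integrable_const schatten_class_scaleC F b p)
      ultimately have "schatten_integrable p \<gamma>
          (\<lambda>s x. (?F (clamp_real a b s) x + ?F (clamp_real b c s) x) + (-1) *\<^sub>C ?F b x)"
        by (rule schatten_integrable_add[OF p])
      moreover have eq: "(?F (clamp_real a b s) x + ?F (clamp_real b c s) x) + (-1) *\<^sub>C ?F b x = ?F (clamp_real a c s) x"
        for s x
      proof (cases "s \<le> b")
        case True
        then have "clamp_real a b s = clamp_real a c s" "clamp_real b c s = b"
          using le by (simp_all add: clamp_real_def)
        then show ?thesis by simp
      next
        case False
        then have "clamp_real b c s = clamp_real a c s" "clamp_real a b s = b"
          using le by (simp_all add: clamp_real_def)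
        then show ?thesis by simp
      qed
      ultimately show "schatten_integrable p \<gamma> (\<lambda>s. ?F (clamp_real a c s))" 
        by (simp only: eq)
    qed
  next
    fix u :: real assume "0 \<le> u" "u \<le> 1"
    then have u: "u \<in> {0..1}" by simp
    show "\<exists>d>0. \<forall>a b. a \<le> u \<and> u \<le> b \<and> b - a < d \<longrightarrow> P a b"
      using locally_schatten_integrable[OF p \<gamma> cont' T spec F u] unfolding P_def by blast
  qed
  then have "schatten_integrable p \<gamma> (\<lambda>s. ?F (clamp_real 0 1 s))" by (simp add: P_def)
  then show ?thesis
    by (rule iffD1[OF schatten_integrable_cong, rotated]) (simp add: clamp_real_def)
qed

lemma riemann_integrable_along_if_schatten_integrable:
  assumes p: "0 < p" and F: "schatten_integrable p \<gamma> (\<lambda>s. F (\<gamma> s))"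
  shows "riemann_integrable_along \<gamma> (schatten_class p) (schatten_norm p) F"
proof -
  have sum: "stieltjes_sum \<gamma> (\<lambda>s. F (\<gamma> s) x) n t \<tau> = riemann_sum \<gamma> F n t \<tau> x" for n t \<tau> x
    by (simp add: stieltjes_sum_def riemann_sum_def)
  let ?E = "\<lambda>I n t \<tau> x. riemann_sum \<gamma> F n t \<tau> x - I x"
  obtain I where I: "I \<in> schatten_class p" "\<And>\<epsilon>. 0 < \<epsilon> \<Longrightarrow> \<exists>\<delta>>0. \<forall>n t \<tau>. tagged_partition \<delta> n t \<tau> \<longrightarrow>
      ?E I n t \<tau> \<in> schatten_class p \<and> schatten_sum p (?E I n t \<tau>) < \<epsilon>"
    using F unfolding schatten_integrable_def sum by blast
  have "\<exists>\<delta>>0. \<forall>n t \<tau>. tagged_partition \<delta> n t \<tau> \<longrightarrow>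
      ?E I n t \<tau> \<in> schatten_class p \<and> schatten_norm p (?E I n t \<tau>) < \<epsilon>" if \<epsilon>: "0 < \<epsilon>" for \<epsilon>
  proof -
    obtain \<delta> where \<delta>: "0 < \<delta>" "\<And>n t \<tau>. tagged_partition \<delta> n t \<tau> \<Longrightarrow>
        ?E I n t \<tau> \<in> schatten_class p \<and> schatten_sum p (?E I n t \<tau>) < \<epsilon> powr p"
      using I(2)[of "\<epsilon> powr p"] \<epsilon> by auto
    have "schatten_norm p (?E I n t \<tau>) < \<epsilon>" if P: "tagged_partition \<delta> n t \<tau>" for n t \<tau>
    proof -
      have V: "?E I n t \<tau> \<in> schatten_class p" and lt: "schatten_sum p (?E I n t \<tau>) < \<epsilon> powr p"
        using \<delta>(2)[OF P] by simp_all
      have "schatten_norm p (?E I n t \<tau>) = schatten_sum p (?E I n t \<tau>) powr (1/p)"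
        using V by (intro schatten_norm_eq) (simp add: schatten_class_iff)
      also have "\<dots> < (\<epsilon> powr p) powr (1/p)"
        using lt p schatten_sum_nonneg[OF V] by (intro powr_less_mono2) simp_all
      also have "\<dots> = \<epsilon>" using p \<epsilon> by (simp add: powr_powr)
      finally show ?thesis .
    qed
    then show ?thesis using \<delta> by blast
  qed
  then show ?thesis unfolding riemann_integrable_along_def using I(1) by blast
qed

theorem proposition4p11:
  fixes S T :: "'a::chilbert_space \<Rightarrow> 'a" and p :: real and \<gamma> :: "real \<Rightarrow> complex"
  assumes "separable_space (euclidean :: 'a topology)"
    and "0 < p" and "p < 1"
    and "bounded_clinear S" and "bounded_clinear T"
    and "commutator S T \<in> schatten_class p"
    and "C1_simple_closed_curve \<gamma>"
    and "path_image \<gamma> \<subseteq> - spectrum S"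
  shows "(\<forall>z\<in>path_image \<gamma>. commutator (resolvent S z) T \<in> schatten_class p) \<and>
    riemann_integrable_along \<gamma> (schatten_class p) (schatten_norm p)
      (\<lambda>z. commutator (resolvent S z) T)"
proof
  note p = \<open>0 < p\<close> and T = \<open>bounded_clinear T\<close>
  show mem: "\<forall>z\<in>path_image \<gamma>. commutator (resolvent S z) T \<in> schatten_class p"
  proof
    fix z assume "z \<in> path_image \<gamma>"
    then have z: "z \<notin> spectrum S" using assms(8) by blast
    note R = bounded_clinear_resolvent[OF z]
    obtain M where M: "0 < M" "\<And>x. norm (resolvent S z x) \<le> M * norm x"
      using bounded_clinear_bound[OF R] by blast
    note M0 = less_imp_le[OF M(1)]
    have "(\<lambda>x. commutator S T (resolvent S z x)) \<in> schatten_class p"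
      by (rule schatten_class_compose_right(1)[OF assms(6) R p M0 M(2)])
    from schatten_class_compose_left(1)[OF this R p M0 M(2)]
    show "commutator (resolvent S z) T \<in> schatten_class p"
      by (simp add: commutator_resolvent[OF T z])
  qed
  obtain \<gamma>' where \<gamma>': "continuous_on {0..1} \<gamma>'"
    "\<And>t. t \<in> {0..1} \<Longrightarrow> (\<gamma> has_vector_derivative \<gamma>' t) (at t within {0..1})"
    using assms(7) unfolding C1_simple_closed_curve_def by blast
  have on: "\<gamma> s \<in> path_image \<gamma>" if "s \<in> {0..1}" for s using that by (simp add: path_image_def)
  have "schatten_integrable p \<gamma> (\<lambda>s. commutator (resolvent S (\<gamma> s)) T)"
    by (rule schatten_integrable_commutator_resolvent[OF p \<gamma>'(2,1) T])
       (use on mem assms(8) in blast)+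
  then show "riemann_integrable_along \<gamma> (schatten_class p) (schatten_norm p)
      (\<lambda>z. commutator (resolvent S z) T)"
    by (rule riemann_integrable_along_if_schatten_integrable[OF p])
qed

end
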